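(* Let $r\ge 3$ be an integer and let $n$ be sufficiently large. Suppose $H$ is a $4$-uniform hypergraph on $n$ vertices with at least $\left(\frac{r-2}{r-1}-10^{-33}r^{-70}\right)\binom{n}{4}$ edges which contains no copy of ${\cal C}^{(4)}_r$. Then $r=2^p+1$ for some integer $p\ge 1$.
   Context: ${\cal C}^{(4)}_r$ is the $4$-uniform hypergraph obtained by taking pairwise disjoint sets $P_1,\dots,P_r$ each of size $2$ and taking as edges all sets $P_i\cup P_j$ with $i\neq j$. *)

theory Defs
  imports Complex_Main
begin

definition uniform4_hypergraph :: "'a set \<Rightarrow> 'a set set \<Rightarrow> bool" where
  "uniform4_hypergraph V E \<longleftrightarrow> finite V \<and> (\<forall>e\<in>E. e \<subseteq> V \<and> card e = 4)"

definition C4_vertices :: "nat \<Rightarrow> (nat \<times> nat) set" where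
  "C4_vertices r = {0..<r} \<times> {0..<2}"

definition C4_pair :: "nat \<Rightarrow> (nat \<times> nat) set" where
  "C4_pair i = {(i,0), (i,1)}"

definition C4_edges :: "nat \<Rightarrow> (nat \<times> nat) set set" where
  "C4_edges r = {C4_pair i \<union> C4_pair j | i j. i < r \<and> j < r \<and> i \<noteq> j}"

definition contains_C4 :: "nat \<Rightarrow> 'a set \<Rightarrow> 'a set set \<Rightarrow> bool" where
  "contains_C4 r V E \<longleftrightarrow> (\<exists>f. inj_on f (C4_vertices r) \<and> f ` C4_vertices r \<subseteq> V \<and>
      (\<forall>e\<in>C4_edges r. f ` e \<in> E))"

end

theory Submission
  imports Defs "HOL-Analysis.Convex"
begin

text \<open>
  Put \<open>k = r - 1\<close> and let two disjoint pairs of vertices be adjacent if their union is an edge.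
  This graph has no clique on \<open>k + 1\<close> pairs and nearly as many edges as a Turan graph allows, so
  by stability the pairs can be coloured with \<open>k\<close> colours such that, up to few exceptions, adjacent
  means differently coloured. An edge of the hypergraph splits into two pairs in three ways, hence
  for most quadruples \<open>f ab = f cd\<close> holds iff \<open>f ac = f bd\<close> does. Counting such quadruples over
  fixed \<open>a\<close> and \<open>c\<close> shows that the vectors of colour degrees have nearly constant inner products;
  as they live in dimension \<open>k\<close>, most of them are nearly uniform. So some vertex \<open>v\<close> sees every
  colour often, and a random choice of a bounded number of neighbours of each colour gives a
  configuration without exceptional quadruples. There \<open>f va \<circ> f vb = f ab\<close> is a well defined group
  operation on the colours in which every element is its own inverse, so \<open>k\<close> is a power of two.
\<close>

subsection \<open>Exact colourings\<close>

lemma card_involutive_semigroup_power_of_two: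
  fixes m :: "'b \<Rightarrow> 'b \<Rightarrow> 'b"
  assumes fin: "finite C" and ne: "C \<noteq> {}"
    and closed: "\<And>x y. x \<in> C \<Longrightarrow> y \<in> C \<Longrightarrow> m x y \<in> C"
    and comm: "\<And>x y. x \<in> C \<Longrightarrow> y \<in> C \<Longrightarrow> m x y = m y x"
    and assoc: "\<And>x y z. x \<in> C \<Longrightarrow> y \<in> C \<Longrightarrow> z \<in> C \<Longrightarrow> m (m x y) z = m x (m y z)"
    and cancel: "\<And>x y. x \<in> C \<Longrightarrow> y \<in> C \<Longrightarrow> m x (m x y) = y"
  shows "\<exists>p. card C = 2 ^ p"
proof -
  define Q where "Q S \<longleftrightarrow> S \<subseteq> C \<and> (\<exists>p. card S = 2 ^ p) \<and> (\<forall>x\<in>S. \<forall>y\<in>S. m x y \<in> S)" for S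
  obtain x where x: "x \<in> C" using ne by blast
  define e where "e = m x x"
  have e: "e \<in> C" unfolding e_def using closed x by blast
  \<comment> \<open>\<open>e\<close> is the neutral element of the group; the closed set
    \<open>{e}\<close>, of size \<open>2 ^ 0\<close>, starts the search for
    \<open>S\<close>.\<close>
  have "m e e = e"
    unfolding e_def using assoc[of x x "m x x"] cancel[of x "m x x"] cancel[of x x] closed x by simp
  then have "Q {e}" unfolding Q_def using e by (auto intro: exI[of _ 0])
  moreover have "\<forall>T. Q T \<longrightarrow> card T < Suc (card C)"
    unfolding Q_def using fin by (simp add: card_mono less_Suc_eq_le)
  ultimately obtain S where S: "Q S" and max: "\<And>T. Q T \<Longrightarrow> card T \<le> card S"
    using ex_has_greatest_nat[of Q "{e}" card "Suc (card C)"] by blast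
  have SC: "S \<subseteq> C" and cl: "\<And>x y. x \<in> S \<Longrightarrow> y \<in> S \<Longrightarrow> m x y \<in> S"
    using S unfolding Q_def by auto
  obtain p where p: "card S = 2 ^ p" using S unfolding Q_def by auto
  have "S = C"
  proof (rule ccontr)
    assume "S \<noteq> C"
    then obtain z where z: "z \<in> C" "z \<notin> S" using SC by blast
    let ?T = "S \<union> m z ` S"
    have inj: "inj_on (m z) S"
      by (rule inj_onI) (metis SC cancel subsetD z(1))
    \<comment> \<open>If \<open>y\<close> and \<open>m z y\<close> both lay in \<open>S\<close>, so
      would their product, which is \<open>z\<close>.\<close>
    have disj: "S \<inter> m z ` S = {}"
    proof (rule ccontr)
      assume "S \<inter> m z ` S \<noteq> {}"
      then obtain y where y: "y \<in> S" "m z y \<in> S" by blast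
      have "m y (m z y) = z" using y SC z closed comm cancel by (metis subsetD)
      then show False using cl[OF y] z by simp
    qed
    have "finite S" using SC fin finite_subset by blast
    then have c: "card ?T = 2 ^ Suc p"
      using card_Un_disjoint[of S "m z ` S"] disj card_image[OF inj] p by simp
    have 1: "m a (m z b) \<in> ?T" if "a \<in> S" "b \<in> S" for a b
    proof -
      have "m a (m z b) = m z (m a b)"
        using that SC z assoc comm by (metis subsetD)
      then show ?thesis using cl[OF that] by auto
    qed
    have 2: "m (m z a) (m z b) \<in> ?T" if "a \<in> S" "b \<in> S" for a b
    proof -
      have ab: "a \<in> C" "b \<in> C" using that SC by auto
      have "m (m z a) (m z b) = m (m a z) (m z b)" using comm[of z a] ab z by simp
      also have "\<dots> = m a (m z (m z b))" using assoc[of a z "m z b"] ab z closed by simp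
      also have "\<dots> = m a b" using cancel ab z by simp
      finally show ?thesis using cl[OF that] by auto
    qed
    have 3: "m (m z b) a \<in> ?T" if "a \<in> S" "b \<in> S" for a b
      using 1[OF that] comm[of "m z b" a] that SC z closed by (metis subsetD)
    have "Q ?T" unfolding Q_def
    proof (intro conjI ballI)
      show "?T \<subseteq> C" using SC z closed by auto
      show "\<exists>p. card ?T = 2 ^ p" using c by blast
      show "m x y \<in> ?T" if "x \<in> ?T" "y \<in> ?T" for x y
        using that by (elim UnE imageE; hypsubst_thin?) (assumption | rule 1 2 3 | rule UnI1, rule cl)+
    qed
    then show False using max[of ?T] c p by simp
  qed
  then show ?thesis using p by blast
qed

lemma obtain_notin:
  assumes "finite F" "card F < card X"
  obtains x where "x \<in> X" "x \<notin> F"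
  using assms by (metis card_mono linorder_not_le subsetI)

text \<open>The star at \<open>v\<close> supplies representatives: a colour \<open>i\<close> stands
  for any \<open>a\<close> with \<open>f v a = i\<close>, and the product of two colours is the
  colour of the edge joining two representatives. Six representatives per colour leave room to
  choose each new one away from the vertices already in use.\<close>

lemma quadrangle_colouring_power_of_two:
  fixes f :: "'a \<Rightarrow> 'a \<Rightarrow> nat"
  assumes k: "k > 0"
    and sym: "\<And>a b. f a b = f b a" and range: "\<And>a b. f a b < k"
    and v: "v \<notin> A"
    and deg: "\<And>i. i < k \<Longrightarrow> card {a \<in> A. f v a = i} \<ge> 6"
    and quad: "\<And>a b c d. {a, b, c, d} \<subseteq> insert v A \<Longrightarrow> distinct [a, b, c, d] \<Longrightarrow>
                 f a b = f c d \<Longrightarrow> f a c = f b d"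
  shows "\<exists>p. k = 2 ^ p"
proof -
  have pick: "\<exists>a\<in>A. f v a = i \<and> a \<notin> set xs" if "i < k" "length xs < 6" for i xs
  proof -
    have "card (set xs) < card {a \<in> A. f v a = i}"
      using deg[OF that(1)] that(2) card_length[of xs] by linarith
    then show ?thesis using obtain_notin[of "set xs" "{a \<in> A. f v a = i}"] by auto
  qed
  have vq: "f v a = f b c \<Longrightarrow> f v b = f a c" if "a \<in> A" "b \<in> A" "c \<in> A" "distinct [a,b,c]" for a b c
    using quad[of v a b c] that v by auto
  \<comment> \<open>A vertex \<open>d\<close> with \<open>f v d = f a e\<close> mediates. The
    quadruple \<open>v, d, a, e\<close> gives \<open>f v a = f d e\<close>; since
    \<open>f v a' = f v a\<close>, the quadruple \<open>v, a', d, e\<close> turns this into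
    \<open>f v d = f a' e\<close>.\<close>
  have twin: "f a e = f a' e" if h: "a \<in> A" "a' \<in> A" "e \<in> A" "a \<noteq> e" "a' \<noteq> e" "f v a = f v a'" for a a' e
  proof (cases "a = a'")
    case False
    obtain d where d: "d \<in> A" "f v d = f a e" "d \<notin> set [a, a', e]"
      using pick[OF range[of a e], of "[a,a',e]"] by auto
    have "f v a = f d e" using vq[of d a e] d h by auto
    then show ?thesis using vq[of a' d e] d h by auto
  qed simp
  have wd: "f a b = f a' b'"
    if h: "a \<in> A" "a' \<in> A" "b \<in> A" "b' \<in> A" "a \<noteq> b" "a' \<noteq> b'" "f v a = f v a'" "f v b = f v b'" for a a' b b'
  proof -
    \<comment> \<open>Replacing \<open>a\<close> by \<open>a'\<close> directly may fail, because
      \<open>a'\<close> can equal \<open>b\<close>. The detour through the fresh \<open>c\<close>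
      keeps the end points distinct in every application of \<open>twin\<close>.\<close>
    obtain c where c: "c \<in> A" "f v c = f v a" "c \<notin> set [a,a',b,b']"
      using pick[OF range[of v a], of "[a,a',b,b']"] by auto
    have "f a b = f c b" using twin[of a c b] c h by auto
    also have "\<dots> = f c b'" using twin[of b b' c] c h sym by auto
    also have "\<dots> = f a' b'" using twin[of c a' b'] c h by auto
    finally show ?thesis .
  qed
  define m where "m i j = (SOME l. \<exists>a\<in>A. \<exists>b\<in>A. a \<noteq> b \<and> f v a = i \<and> f v b = j \<and> l = f a b)" for i j
  have m: "m (f v a) (f v b) = f a b" if "a \<in> A" "b \<in> A" "a \<noteq> b" for a b
    unfolding m_def
  proof (rule some_equality)
    show "\<exists>x\<in>A. \<exists>y\<in>A. x \<noteq> y \<and> f v x = f v a \<and> f v y = f v b \<and> f a b = f x y"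
      using that by blast
    show "l = f a b" if "\<exists>x\<in>A. \<exists>y\<in>A. x \<noteq> y \<and> f v x = f v a \<and> f v y = f v b \<and> l = f x y" for l
      using that wd[of _ a _ b] \<open>a \<in> A\<close> \<open>b \<in> A\<close> \<open>a \<noteq> b\<close> by blast
  qed
  have two: "\<exists>a\<in>A. \<exists>b\<in>A. a \<noteq> b \<and> f v a = i \<and> f v b = j" if ij: "i < k" "j < k" for i j
  proof -
    obtain a where a: "a \<in> A" "f v a = i" using pick[OF ij(1), of "[]"] by auto
    obtain b where b: "b \<in> A" "f v b = j" "b \<noteq> a" using pick[OF ij(2), of "[a]"] by auto
    show ?thesis using a b by (intro bexI[of _ a] bexI[of _ b]) auto
  qed
  have mex: "m i j < k \<and> m i j = m j i" if ij: "i < k" "j < k" for i j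
  proof -
    obtain a b where "a \<in> A" "b \<in> A" "a \<noteq> b" "f v a = i" "f v b = j" using two[OF ij] by blast
    then show ?thesis using m[of a b] m[of b a] range[of a b] sym[of a b] by auto
  qed
  then have closed: "\<And>i j. i < k \<Longrightarrow> j < k \<Longrightarrow> m i j < k"
    and comm: "\<And>i j. i < k \<Longrightarrow> j < k \<Longrightarrow> m i j = m j i" by blast+
  have cancel: "m i (m i j) = j" if ij: "i < k" "j < k" for i j
  proof -
    obtain a where a: "a \<in> A" "f v a = i" using pick[OF ij(1), of "[]"] by auto
    obtain b where b: "b \<in> A" "f v b = j" "b \<noteq> a" using pick[OF ij(2), of "[a]"] by auto
    obtain d where d: "d \<in> A" "f v d = m i j" "d \<noteq> a" "d \<noteq> b"
      using pick[OF closed[OF ij], of "[a,b]"] by auto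
    have "f v d = f b a" using d m[of a b] a b sym by simp
    then have "f v b = f d a" using vq[of d b a] a b d by auto
    then show ?thesis using m[of a d] a b d sym by auto
  qed
  have assoc: "m (m i j) l = m i (m j l)" if ijl: "i < k" "j < k" "l < k" for i j l
  proof -
    obtain a where a: "a \<in> A" "f v a = i" using pick[OF ijl(1), of "[]"] by auto
    obtain c where c: "c \<in> A" "f v c = l" "c \<notin> set [a]" using pick[OF ijl(3), of "[a]"] by auto
    obtain d where d: "d \<in> A" "f v d = m i j" "d \<notin> set [a,c]"
      using pick[OF closed[OF ijl(1,2)], of "[a,c]"] by auto
    obtain e where e: "e \<in> A" "f v e = m j l" "e \<notin> set [a,c,d]"
      using pick[OF closed[OF ijl(2,3)], of "[a,c,d]"] by auto
    \<comment> \<open>Associativity is one quadrangle: by cancellation the edges \<open>da\<close>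
      and \<open>ce\<close> both have colour \<open>j\<close>, so \<open>dc\<close> and
      \<open>ae\<close> agree, and their colours are the two ways of bracketing.\<close>
    have "f d a = j" using m[of a d] a d sym cancel[OF ijl(1,2)] by auto
    moreover have "f c e = j" using m[of c e] c e comm[OF ijl(2,3)] cancel[OF ijl(3,2)] by auto
    ultimately have "f d c = f a e" using quad[of d a c e] a c d e by auto
    then show ?thesis using m[of d c] m[of a e] a c d e by auto
  qed
  have "\<exists>p. card {..<k} = 2 ^ p"
    by (rule card_involutive_semigroup_power_of_two[of _ m])
       (use k closed comm assoc cancel in auto)
  then show ?thesis by simp
qed

subsection \<open>Colourings with few exceptional quadruples\<close>

text \<open>Only two of the three splittings into pairs are compared; permuting the arguments gives
  the other comparisons. Quadruples with a repetition count as exceptional, which costs only order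
  \<open>n ^ 3\<close> and later yields distinctness of chosen vertices for free.\<close>

definition good_quadruple :: "('a \<Rightarrow> 'a \<Rightarrow> 'c) \<Rightarrow> 'a \<Rightarrow> 'a \<Rightarrow> 'a \<Rightarrow> 'a \<Rightarrow> bool" where
  "good_quadruple f a b c d \<longleftrightarrow> distinct [a, b, c, d] \<and> (f a b = f c d \<longleftrightarrow> f a c = f b d)"

text \<open>Let \<open>x a\<close> be the vector of colour degrees at \<open>a\<close> minus the
  uniform vector. Its inner product with \<open>x c\<close> is \<open>T a c - n\<^sup>2 / K\<close>.
  Good quadruples make \<open>T a c\<close> close to \<open>Q (f a c)\<close>, the size of a colour
  class, and \<open>same\<close> makes the class sizes nearly equal, so the inner products are small
  on average. In dimension \<open>k\<close> this forces the squared norms \<open>g a\<close> to be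
  small on average as well, and a vertex with small \<open>g\<close> has all its colour degrees near
  \<open>n / K\<close>.\<close>

lemma exists_rich_vertex:
  fixes f :: "'a \<Rightarrow> 'a \<Rightarrow> nat" and \<beta> :: real
  assumes fin: "finite V" and n: "n = real (card V)" "n > 0" and k: "k > 0" and \<beta>: "\<beta> > 0"
    and range: "\<And>a b. f a b < k"
    and bad: "(\<Sum>a\<in>V. \<Sum>b\<in>V. \<Sum>c\<in>V. \<Sum>d\<in>V. of_bool (\<not> good_quadruple f a b c d)) \<le> \<beta> * n ^ 4"
    and same: "(\<Sum>a\<in>V. \<Sum>b\<in>V. \<Sum>c\<in>V. \<Sum>d\<in>V. of_bool (f a b = f c d)) \<le> (1 / real k + \<beta>) * n ^ 4"
    and small: "256 * real k ^ 5 * \<beta> < 1"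
  shows "\<exists>v\<in>V. (\<forall>i<k. real (card {a \<in> V. f v a = i}) \<ge> n / (2 * real k)) \<and>
    (\<Sum>a\<in>V. \<Sum>b\<in>V. \<Sum>c\<in>V. of_bool (\<not> good_quadruple f v a b c)) \<le> 2 * \<beta> * n ^ 3"
proof -
  define K where "K = real k"
  have K: "K > 0" "K \<ge> 1" unfolding K_def using k by auto
  define deg where "deg a i = (\<Sum>b\<in>V. of_bool (f a b = i) :: real)" for a i
  define x where "x a i = deg a i - n / K" for a i
  define Q where "Q i = (\<Sum>a\<in>V. \<Sum>b\<in>V. of_bool (f a b = i) :: real)" for i
  define T where "T a c = (\<Sum>b\<in>V. \<Sum>d\<in>V. of_bool (f a b = f c d) :: real)" for a c
  define B where "B a c = (\<Sum>b\<in>V. \<Sum>d\<in>V. of_bool (\<not> good_quadruple f a b c d) :: real)" for a c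
  have one: "(\<Sum>i<k. of_bool (f a b = i) * h i) = h (f a b)" for a b and h :: "nat \<Rightarrow> real"
    using range[of a b] by (simp add: of_bool_def if_distrib[where f = "\<lambda>y. y * _"] cong: if_cong)
  have by_colour: "(\<Sum>a\<in>V. \<Sum>b\<in>V. h (f a b)) = (\<Sum>i<k. Q i * h i)" for h :: "nat \<Rightarrow> real"
  proof -
    have "(\<Sum>i<k. Q i * h i) = (\<Sum>i<k. \<Sum>a\<in>V. \<Sum>b\<in>V. of_bool (f a b = i) * h i)"
      unfolding Q_def by (simp only: sum_distrib_right)
    also have "\<dots> = (\<Sum>a\<in>V. \<Sum>i<k. \<Sum>b\<in>V. of_bool (f a b = i) * h i)" by (rule sum.swap)
    also have "\<dots> = (\<Sum>a\<in>V. \<Sum>b\<in>V. \<Sum>i<k. of_bool (f a b = i) * h i)"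
      by (intro sum.cong refl sum.swap)
    finally show ?thesis unfolding one by simp
  qed
  have deg_sum: "(\<Sum>i<k. deg a i) = n" for a
  proof -
    have "(\<Sum>i<k. deg a i) = (\<Sum>b\<in>V. \<Sum>i<k. of_bool (f a b = i) * 1)"
      unfolding deg_def by (subst sum.swap) simp
    then show ?thesis unfolding one using n by simp
  qed
  have T_deg: "T a c = (\<Sum>i<k. deg a i * deg c i)" for a c
  proof -
    have "(\<Sum>i<k. deg a i * deg c i) = (\<Sum>i<k. \<Sum>b\<in>V. \<Sum>d\<in>V. of_bool (f a b = i) * of_bool (f c d = i))"
      unfolding deg_def sum_product ..
    also have "\<dots> = (\<Sum>b\<in>V. \<Sum>i<k. \<Sum>d\<in>V. of_bool (f a b = i) * of_bool (f c d = i))" by (rule sum.swap)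
    also have "\<dots> = (\<Sum>b\<in>V. \<Sum>d\<in>V. \<Sum>i<k. of_bool (f a b = i) * of_bool (f c d = i))"
      by (intro sum.cong refl sum.swap)
    also have "\<dots> = T a c" unfolding one T_def by (intro sum.cong refl) (auto simp: of_bool_def)
    finally show ?thesis by simp
  qed
  have ip: "(\<Sum>i<k. x a i * x c i) = T a c - n\<^sup>2 / K" for a c
  proof -
    have "(\<Sum>i<k. x a i * x c i) = (\<Sum>i<k. deg a i * deg c i - n / K * deg a i - n / K * deg c i + (n / K)\<^sup>2)"
      unfolding x_def by (intro sum.cong refl) (simp add: algebra_simps power2_eq_square)
    also have "\<dots> = T a c - n / K * n - n / K * n + K * (n / K)\<^sup>2"
      unfolding sum.distrib sum_subtractf sum_distrib_left[symmetric] deg_sum T_deg by (simp add: K_def)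
    also have "\<dots> = T a c - n\<^sup>2 / K" using K by (simp add: field_simps power2_eq_square)
    finally show ?thesis .
  qed
  have bnd: "0 \<le> (\<Sum>b\<in>V. \<Sum>d\<in>V. of_bool (P b d) :: real)" "(\<Sum>b\<in>V. \<Sum>d\<in>V. of_bool (P b d) :: real) \<le> n\<^sup>2" for P
  proof -
    show "0 \<le> (\<Sum>b\<in>V. \<Sum>d\<in>V. of_bool (P b d) :: real)" by (intro sum_nonneg) auto
    have "(\<Sum>b\<in>V. \<Sum>d\<in>V. of_bool (P b d) :: real) \<le> (\<Sum>b\<in>V. \<Sum>d\<in>V. 1)"
      by (intro sum_mono) auto
    then show "(\<Sum>b\<in>V. \<Sum>d\<in>V. of_bool (P b d) :: real) \<le> n\<^sup>2" using n by (simp add: power2_eq_square)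
  qed
  \<comment> \<open>The difference is at most \<open>B a c\<close> and also at most
    \<open>n\<^sup>2\<close>; multiplying the two bounds gives a second moment that is linear in the
    number of exceptions.\<close>
  have TQ: "(T a c - Q (f a c))\<^sup>2 \<le> n\<^sup>2 * B a c" for a c
  proof -
    have "\<bar>T a c - Q (f a c)\<bar> = \<bar>\<Sum>b\<in>V. \<Sum>d\<in>V. of_bool (f a b = f c d) - of_bool (f b d = f a c)\<bar>"
      unfolding T_def Q_def by (simp only: sum_subtractf)
    also have "\<dots> \<le> (\<Sum>b\<in>V. \<Sum>d\<in>V. \<bar>of_bool (f a b = f c d) - of_bool (f b d = f a c)\<bar>)"
      by (rule order.trans[OF sum_abs]) (intro sum_mono sum_abs)
    also have "\<dots> \<le> B a c" unfolding B_def good_quadruple_def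
    proof (intro sum_mono)
      fix b d
      have *: "\<bar>of_bool p - of_bool q\<bar> \<le> (of_bool (\<not> (s \<and> (p \<longleftrightarrow> q))) :: real)" for p q s
        by (cases p; cases q; cases s) simp_all
      show "\<bar>of_bool (f a b = f c d) - of_bool (f b d = f a c)\<bar>
        \<le> (of_bool (\<not> (distinct [a, b, c, d] \<and> (f a b = f c d \<longleftrightarrow> f a c = f b d))) :: real)"
        unfolding eq_commute[of "f b d"] by (rule *)
    qed
    finally have 1: "\<bar>T a c - Q (f a c)\<bar> \<le> B a c" .
    have 2: "\<bar>T a c - Q (f a c)\<bar> \<le> n\<^sup>2"
      using bnd[of "\<lambda>b d. f a b = f c d"] bnd[of "\<lambda>b d. f b d = f a c"] unfolding T_def Q_def by linarith
    have "(T a c - Q (f a c))\<^sup>2 = \<bar>T a c - Q (f a c)\<bar> * \<bar>T a c - Q (f a c)\<bar>"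
      by (simp add: power2_eq_square)
    also have "\<dots> \<le> n\<^sup>2 * B a c" by (rule mult_mono[OF 2 1]) auto
    finally show ?thesis .
  qed
  have Bsum: "(\<Sum>a\<in>V. \<Sum>c\<in>V. B a c) \<le> \<beta> * n ^ 4"
  proof -
    have "(\<Sum>a\<in>V. \<Sum>c\<in>V. B a c) = (\<Sum>a\<in>V. \<Sum>b\<in>V. \<Sum>c\<in>V. \<Sum>d\<in>V. of_bool (\<not> good_quadruple f a b c d))"
      unfolding B_def by (intro sum.cong refl sum.swap)
    then show ?thesis using bad by simp
  qed
  have Qsum: "(\<Sum>i<k. Q i) = n\<^sup>2"
    using by_colour[of "\<lambda>_. 1"] n by (simp add: power2_eq_square)
  \<comment> \<open>The sum of the squared class sizes counts the quadruples in \<open>same\<close>.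
    Near the Cauchy-Schwarz minimum \<open>n ^ 4 / K\<close> it bounds the variance of the class
    sizes.\<close>
  have Qsq: "(\<Sum>i<k. (Q i)\<^sup>2) \<le> (1 / K + \<beta>) * n ^ 4"
  proof -
    have "(\<Sum>i<k. (Q i)\<^sup>2) = (\<Sum>a\<in>V. \<Sum>b\<in>V. Q (f a b))"
      unfolding by_colour by (simp add: power2_eq_square)
    also have "\<dots> = (\<Sum>a\<in>V. \<Sum>b\<in>V. \<Sum>c\<in>V. \<Sum>d\<in>V. of_bool (f a b = f c d))"
      unfolding Q_def by (intro sum.cong refl) (simp add: eq_commute)
    finally show ?thesis using same K_def by simp
  qed
  have Qdev: "(\<Sum>i<k. (Q i - n\<^sup>2 / K)\<^sup>2) \<le> \<beta> * n ^ 4"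
  proof -
    have "(\<Sum>i<k. (Q i - n\<^sup>2 / K)\<^sup>2) = (\<Sum>i<k. (Q i)\<^sup>2 - 2 * (n\<^sup>2 / K) * Q i + (n\<^sup>2 / K)\<^sup>2)"
      by (intro sum.cong refl) (simp add: algebra_simps power2_eq_square)
    also have "\<dots> = (\<Sum>i<k. (Q i)\<^sup>2) - 2 * (n\<^sup>2 / K) * n\<^sup>2 + K * (n\<^sup>2 / K)\<^sup>2"
      unfolding sum.distrib sum_subtractf sum_distrib_left[symmetric] Qsum by (simp add: K_def)
    also have "\<dots> = (\<Sum>i<k. (Q i)\<^sup>2) - n ^ 4 / K" using K by (simp add: field_simps power2_eq_square eval_nat_numeral)
    also have "\<dots> \<le> \<beta> * n ^ 4" using Qsq by (simp add: algebra_simps)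
    finally show ?thesis .
  qed
  have Qdev': "(\<Sum>a\<in>V. \<Sum>c\<in>V. (Q (f a c) - n\<^sup>2 / K)\<^sup>2) \<le> \<beta> * n ^ 6"
  proof -
    have "(\<Sum>a\<in>V. \<Sum>c\<in>V. (Q (f a c) - n\<^sup>2 / K)\<^sup>2) = (\<Sum>i<k. Q i * (Q i - n\<^sup>2 / K)\<^sup>2)"
      by (rule by_colour)
    also have "\<dots> \<le> (\<Sum>i<k. n\<^sup>2 * (Q i - n\<^sup>2 / K)\<^sup>2)"
      using bnd unfolding Q_def by (intro sum_mono mult_right_mono) auto
    also have "\<dots> = n\<^sup>2 * (\<Sum>i<k. (Q i - n\<^sup>2 / K)\<^sup>2)" by (simp only: sum_distrib_left)
    also have "\<dots> \<le> n\<^sup>2 * (\<beta> * n ^ 4)" using Qdev by (intro mult_left_mono) auto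
    also have "\<dots> = \<beta> * n ^ 6" by (simp add: power2_eq_square eval_nat_numeral)
    finally show ?thesis .
  qed
  have "(\<Sum>a\<in>V. \<Sum>c\<in>V. (\<Sum>i<k. x a i * x c i)\<^sup>2) \<le> (\<Sum>a\<in>V. \<Sum>c\<in>V. 2 * (n\<^sup>2 * B a c) + 2 * (Q (f a c) - n\<^sup>2 / K)\<^sup>2)"
  proof (intro sum_mono)
    fix a c
    have "(p + q)\<^sup>2 \<le> 2 * p\<^sup>2 + 2 * q\<^sup>2" for p q :: real
      using zero_le_power2[of "p - q"] by (simp add: power2_eq_square algebra_simps)
    from this[of "T a c - Q (f a c)" "Q (f a c) - n\<^sup>2 / K"]
    show "(\<Sum>i<k. x a i * x c i)\<^sup>2 \<le> 2 * (n\<^sup>2 * B a c) + 2 * (Q (f a c) - n\<^sup>2 / K)\<^sup>2"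
      unfolding ip using TQ[of a c] by simp
  qed
  also have "\<dots> = 2 * (n\<^sup>2 * (\<Sum>a\<in>V. \<Sum>c\<in>V. B a c)) + 2 * (\<Sum>a\<in>V. \<Sum>c\<in>V. (Q (f a c) - n\<^sup>2 / K)\<^sup>2)"
    by (simp only: sum.distrib sum_distrib_left)
  also have "\<dots> \<le> 2 * (n\<^sup>2 * (\<beta> * n ^ 4)) + 2 * (\<beta> * n ^ 6)"
    using Bsum Qdev' by (intro add_mono mult_left_mono) auto
  also have "\<dots> = 4 * \<beta> * n ^ 6" by (simp add: power2_eq_square eval_nat_numeral)
  finally have ip2: "(\<Sum>a\<in>V. \<Sum>c\<in>V. (\<Sum>i<k. x a i * x c i)\<^sup>2) \<le> 4 * \<beta> * n ^ 6" .
  \<comment> \<open>Compare trace and Frobenius norm of the matrix \<open>G\<close>, which has only \<open>k\<close> rows.\<close>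
  define g where "g a = (\<Sum>i<k. (x a i)\<^sup>2)" for a
  define G where "G i j = (\<Sum>a\<in>V. x a i * x a j)" for i j
  have "(\<Sum>a\<in>V. g a)\<^sup>2 = (\<Sum>i<k. G i i)\<^sup>2"
    unfolding g_def G_def by (subst sum.swap) (simp add: power2_eq_square)
  also have "\<dots> \<le> K * (\<Sum>i<k. (G i i)\<^sup>2)"
    using sum_squared_le_sum_of_squares[of "\<lambda>i. G i i" "{..<k}"] unfolding K_def by (simp add: mult.commute)
  also have "(\<Sum>i<k. (G i i)\<^sup>2) \<le> (\<Sum>i<k. \<Sum>j<k. (G i j)\<^sup>2)"
    by (intro sum_mono member_le_sum) auto
  also have "(\<Sum>i<k. \<Sum>j<k. (G i j)\<^sup>2) = (\<Sum>a\<in>V. \<Sum>c\<in>V. (\<Sum>i<k. x a i * x c i)\<^sup>2)"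
  proof -
    have "(\<Sum>i<k. \<Sum>j<k. (G i j)\<^sup>2) = (\<Sum>i<k. \<Sum>j<k. \<Sum>a\<in>V. \<Sum>c\<in>V. (x a i * x c i) * (x a j * x c j))"
      unfolding G_def power2_eq_square sum_product by (intro sum.cong refl) (simp add: mult_ac)
    also have "\<dots> = (\<Sum>i<k. \<Sum>a\<in>V. \<Sum>j<k. \<Sum>c\<in>V. (x a i * x c i) * (x a j * x c j))"
      by (intro sum.cong refl sum.swap)
    also have "\<dots> = (\<Sum>i<k. \<Sum>a\<in>V. \<Sum>c\<in>V. \<Sum>j<k. (x a i * x c i) * (x a j * x c j))"
      by (intro sum.cong refl sum.swap)
    also have "\<dots> = (\<Sum>a\<in>V. \<Sum>i<k. \<Sum>c\<in>V. \<Sum>j<k. (x a i * x c i) * (x a j * x c j))"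
      by (rule sum.swap)
    also have "\<dots> = (\<Sum>a\<in>V. \<Sum>c\<in>V. \<Sum>i<k. \<Sum>j<k. (x a i * x c i) * (x a j * x c j))"
      by (intro sum.cong refl sum.swap)
    finally show ?thesis unfolding power2_eq_square sum_product .
  qed
  finally have "(\<Sum>a\<in>V. g a)\<^sup>2 \<le> K * (4 * \<beta> * n ^ 6)"
    using ip2 K by (smt (verit) mult_left_mono)
  \<comment> \<open>The right side is \<open>n ^ 6 / (64 * K ^ 4)\<close>, so this is exactly the
    condition \<open>256 * K ^ 5 * \<beta> < 1\<close>.\<close>
  also have "\<dots> < (n ^ 3 / (8 * K\<^sup>2))\<^sup>2"
  proof -
    have "256 * K ^ 5 * \<beta> * n ^ 6 < 1 * n ^ 6"
      using small n unfolding K_def by (intro mult_strict_right_mono) auto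
    then show ?thesis using K by (simp add: field_simps power2_eq_square eval_nat_numeral)
  qed
  finally have gs: "(\<Sum>a\<in>V. g a) < n ^ 3 / (8 * K\<^sup>2)"
    by (rule power_less_imp_less_base) (use n K in auto)
  define b where "b v = (\<Sum>a\<in>V. \<Sum>b\<in>V. \<Sum>c\<in>V. of_bool (\<not> good_quadruple f v a b c) :: real)" for v
  have bs: "(\<Sum>v\<in>V. b v) \<le> \<beta> * n ^ 4" unfolding b_def using bad .
  \<comment> \<open>Both terms are scaled to average at most one half, the first strictly less. A
    vertex where the sum is below 1 therefore satisfies both bounds at once.\<close>
  have "\<exists>v\<in>V. 4 * K\<^sup>2 / n\<^sup>2 * g v + b v / (2 * \<beta> * n ^ 3) < 1"
  proof (rule ccontr)
    assume "\<not> ?thesis"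
    then have "(\<Sum>v\<in>V. 1) \<le> (\<Sum>v\<in>V. 4 * K\<^sup>2 / n\<^sup>2 * g v + b v / (2 * \<beta> * n ^ 3))"
      by (intro sum_mono) force
    then have "n \<le> 4 * K\<^sup>2 / n\<^sup>2 * (\<Sum>v\<in>V. g v) + (\<Sum>v\<in>V. b v) / (2 * \<beta> * n ^ 3)"
      using n by (simp add: sum.distrib sum_divide_distrib sum_distrib_left)
    also have "\<dots> < 4 * K\<^sup>2 / n\<^sup>2 * (n ^ 3 / (8 * K\<^sup>2)) + (\<beta> * n ^ 4) / (2 * \<beta> * n ^ 3)"
      using gs bs n K \<beta> by (intro add_less_le_mono mult_strict_left_mono divide_right_mono) auto
    also have "\<dots> = n" using n K \<beta> by (simp add: field_simps power2_eq_square eval_nat_numeral)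
    finally show False by simp
  qed
  then obtain v where v: "v \<in> V" "4 * K\<^sup>2 / n\<^sup>2 * g v + b v / (2 * \<beta> * n ^ 3) < 1" by blast
  have g0: "g v \<ge> 0" and b0: "b v \<ge> 0" unfolding g_def b_def by (auto intro!: sum_nonneg)
  have t1: "4 * K\<^sup>2 / n\<^sup>2 * g v \<ge> 0" and t2: "b v / (2 * \<beta> * n ^ 3) \<ge> 0"
    using g0 b0 n K \<beta> by auto
  have "b v / (2 * \<beta> * n ^ 3) \<le> 1" using v(2) t1 by linarith
  then have 1: "b v \<le> 2 * \<beta> * n ^ 3" using n \<beta> by (simp add: field_simps)
  have "4 * K\<^sup>2 / n\<^sup>2 * g v < 1" using v(2) t2 by linarith
  then have gv: "g v < (n / (2 * K))\<^sup>2" using n K by (simp add: field_simps power2_eq_square)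
  have 2: "real (card {a \<in> V. f v a = i}) \<ge> n / (2 * K)" if "i < k" for i
  proof -
    have "(x v i)\<^sup>2 \<le> g v" unfolding g_def by (rule member_le_sum) (use that in auto)
    then have sq: "\<bar>x v i\<bar>\<^sup>2 \<le> (n / (2 * K))\<^sup>2" using gv by simp
    have "\<bar>x v i\<bar> \<le> n / (2 * K)" by (rule power2_le_imp_le[OF sq]) (use n K in simp)
    then have "deg v i \<ge> n / K - n / (2 * K)" unfolding x_def by linarith
    moreover have "n / K - n / (2 * K) = n / (2 * K)" using K by (simp add: field_simps)
    moreover have "deg v i = card {a \<in> V. f v a = i}"
      unfolding deg_def using fin by (simp add: of_bool_def sum.If_cases Int_def)
    ultimately show ?thesis by simp
  qed
  show ?thesis using 1 2 v(1) unfolding b_def K_def by blast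
qed

section \<open>Choosing a bounded configuration at random\<close>

text \<open>A union bound in counting form: if every \<open>\<phi> i\<close> is drawn uniformly and
  independently from \<open>N i\<close>, a fixed list \<open>js\<close> of distinct indices lands in
  \<open>B js\<close> with probability at most \<open>card (B js) / t ^ length js\<close>.\<close>

lemma union_bound_choice:
  fixes N :: "'i \<Rightarrow> 'b set" and t :: real
  assumes I: "finite I" and N: "\<And>i. i \<in> I \<Longrightarrow> finite (N i)" "\<And>i. i \<in> I \<Longrightarrow> t \<le> real (card (N i))"
    and t: "t > 0"
    and L: "finite L" "\<And>js. js \<in> L \<Longrightarrow> distinct js \<and> set js \<subseteq> I \<and> finite (B js)"
    and sum: "(\<Sum>js\<in>L. real (card (B js)) / t ^ length js) < 1"
  shows "\<exists>\<phi>. (\<forall>i\<in>I. \<phi> i \<in> N i) \<and> (\<forall>js\<in>L. map \<phi> js \<notin> B js)"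
proof -
  define X where "X = Pi\<^sub>E I N"
  have fX: "finite X" unfolding X_def using I N by (intro finite_PiE) auto
  have cX: "real (card X) = (\<Prod>i\<in>I. real (card (N i)))" unfolding X_def by (simp add: card_PiE[OF I])
  have posX: "real (card X) > 0" unfolding cX using N(2) t by (intro prod_pos) force
  define bad where "bad js = {\<phi> \<in> X. map \<phi> js \<in> B js}" for js
  have bb: "real (card (bad js)) \<le> real (card X) * (real (card (B js)) / t ^ length js)" if "js \<in> L" for js
  proof -
    have js: "distinct js" "set js \<subseteq> I" "finite (B js)" using L(2)[OF that] by auto
    define J where "J = I - set js"
    have fJ: "finite J" unfolding J_def using I by auto
    \<comment> \<open>A bad choice is determined by its values along \<open>js\<close>, which lie in
      \<open>B js\<close>, and its values on the other indices.\<close>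
    have "card (bad js) \<le> card (B js \<times> Pi\<^sub>E J N)"
    proof (rule card_inj_on_le)
      show "inj_on (\<lambda>\<phi>. (map \<phi> js, restrict \<phi> J)) (bad js)"
      proof (rule inj_onI)
        fix \<phi> \<psi> assume a: "\<phi> \<in> bad js" "\<psi> \<in> bad js"
          "(map \<phi> js, restrict \<phi> J) = (map \<psi> js, restrict \<psi> J)"
        have "\<phi> i = \<psi> i" if "i \<in> I" for i
        proof (cases "i \<in> set js")
          case True then show ?thesis using a(3) by auto
        next
          case False
          have "restrict \<phi> J i = restrict \<psi> J i" using a(3) by simp
          then show ?thesis using False that unfolding J_def by simp
        qed
        then show "\<phi> = \<psi>" using a(1,2) unfolding bad_def X_def by (auto intro: PiE_ext)
      qed
      show "(\<lambda>\<phi>. (map \<phi> js, restrict \<phi> J)) ` bad js \<subseteq> B js \<times> Pi\<^sub>E J N"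
        unfolding bad_def X_def J_def by auto
      show "finite (B js \<times> Pi\<^sub>E J N)"
        using js N(1) fJ unfolding J_def by (intro finite_cartesian_product finite_PiE) auto
    qed
    then have 1: "real (card (bad js)) \<le> real (card (B js)) * (\<Prod>i\<in>J. real (card (N i)))"
      by (simp add: card_cartesian_product card_PiE[OF fJ] flip: of_nat_prod of_nat_mult)
    have "t ^ length js = (\<Prod>i\<in>set js. t)" using distinct_card[OF js(1)] by simp
    also have "\<dots> \<le> (\<Prod>i\<in>set js. real (card (N i)))"
      using js(2) N(2) t by (intro prod_mono) force
    finally have 2: "t ^ length js \<le> (\<Prod>i\<in>set js. real (card (N i)))" .
    have "real (card X) = (\<Prod>i\<in>J. real (card (N i))) * (\<Prod>i\<in>set js. real (card (N i)))"
      unfolding cX J_def using prod.subset_diff[OF js(2) I] by simp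
    also have "\<dots> \<ge> (\<Prod>i\<in>J. real (card (N i))) * t ^ length js"
      using 2 by (intro mult_left_mono prod_nonneg) auto
    finally have "(\<Prod>i\<in>J. real (card (N i))) \<le> real (card X) / t ^ length js"
      using t by (simp add: field_simps)
    then have "real (card (B js)) * (\<Prod>i\<in>J. real (card (N i))) \<le> real (card (B js)) * (real (card X) / t ^ length js)"
      by (intro mult_left_mono) auto
    then show ?thesis using 1 by (simp add: mult.commute)
  qed
  have "real (card (\<Union>js\<in>L. bad js)) \<le> (\<Sum>js\<in>L. real (card (bad js)))"
    using card_UN_le[OF L(1), of bad] by (simp flip: of_nat_sum)
  also have "\<dots> \<le> (\<Sum>js\<in>L. real (card X) * (real (card (B js)) / t ^ length js))"
    by (intro sum_mono bb)
  also have "\<dots> = real (card X) * (\<Sum>js\<in>L. real (card (B js)) / t ^ length js)"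
    by (simp only: sum_distrib_left)
  also have "\<dots> < real (card X) * 1" using sum posX by (intro mult_strict_left_mono) auto
  finally have "card (\<Union>js\<in>L. bad js) < card X" by simp
  moreover have "finite (\<Union>js\<in>L. bad js)" using L(1) fX unfolding bad_def by auto
  ultimately obtain \<phi> where "\<phi> \<in> X" "\<phi> \<notin> (\<Union>js\<in>L. bad js)"
    using obtain_notin[of "\<Union>js\<in>L. bad js" X] by auto
  then show ?thesis unfolding bad_def X_def by (intro exI[of _ \<phi>]) auto
qed

lemma card_triples_le_sum:
  fixes P :: "'a \<Rightarrow> 'a \<Rightarrow> 'a \<Rightarrow> bool"
  assumes "finite V"
  shows "finite {[a, b, c] | a b c. a \<in> V \<and> b \<in> V \<and> c \<in> V \<and> P a b c}"
    and "real (card {[a, b, c] | a b c. a \<in> V \<and> b \<in> V \<and> c \<in> V \<and> P a b c})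
      \<le> (\<Sum>a\<in>V. \<Sum>b\<in>V. \<Sum>c\<in>V. of_bool (P a b c))"
proof -
  let ?S = "{x \<in> V \<times> V \<times> V. case x of (a, b, c) \<Rightarrow> P a b c}"
  let ?h = "\<lambda>(a, b, c). [a, b, c]"
  have eq: "{[a, b, c] | a b c. a \<in> V \<and> b \<in> V \<and> c \<in> V \<and> P a b c} = ?h ` ?S" by force
  have fin: "finite (V \<times> V \<times> V)" using assms by auto
  then have fS: "finite ?S" by simp
  then show "finite {[a, b, c] | a b c. a \<in> V \<and> b \<in> V \<and> c \<in> V \<and> P a b c}" unfolding eq by simp
  have "real (card ?S) = (\<Sum>x\<in>V \<times> V \<times> V. of_bool (case x of (a, b, c) \<Rightarrow> P a b c))"
    using fin by (simp add: of_bool_def sum.If_cases Int_def)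
  also have "\<dots> = (\<Sum>a\<in>V. \<Sum>b\<in>V. \<Sum>c\<in>V. of_bool (P a b c))"
    by (simp only: sum.cartesian_product') simp
  finally show "real (card {[a, b, c] | a b c. a \<in> V \<and> b \<in> V \<and> c \<in> V \<and> P a b c})
      \<le> (\<Sum>a\<in>V. \<Sum>b\<in>V. \<Sum>c\<in>V. of_bool (P a b c))"
    unfolding eq using card_image_le[OF fS, of ?h] by simp
qed

lemma card_quadruples_le_sum:
  fixes P :: "'a \<Rightarrow> 'a \<Rightarrow> 'a \<Rightarrow> 'a \<Rightarrow> bool"
  assumes "finite V"
  shows "finite {[a, b, c, d] | a b c d. a \<in> V \<and> b \<in> V \<and> c \<in> V \<and> d \<in> V \<and> P a b c d}"
    and "real (card {[a, b, c, d] | a b c d. a \<in> V \<and> b \<in> V \<and> c \<in> V \<and> d \<in> V \<and> P a b c d})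
      \<le> (\<Sum>a\<in>V. \<Sum>b\<in>V. \<Sum>c\<in>V. \<Sum>d\<in>V. of_bool (P a b c d))"
proof -
  let ?S = "{x \<in> V \<times> V \<times> V \<times> V. case x of (a, b, c, d) \<Rightarrow> P a b c d}"
  let ?h = "\<lambda>(a, b, c, d). [a, b, c, d]"
  have eq: "{[a, b, c, d] | a b c d. a \<in> V \<and> b \<in> V \<and> c \<in> V \<and> d \<in> V \<and> P a b c d} = ?h ` ?S" by force
  have fin: "finite (V \<times> V \<times> V \<times> V)" using assms by auto
  then have fS: "finite ?S" by simp
  then show "finite {[a, b, c, d] | a b c d. a \<in> V \<and> b \<in> V \<and> c \<in> V \<and> d \<in> V \<and> P a b c d}" unfolding eq by simp
  have "real (card ?S) = (\<Sum>x\<in>V \<times> V \<times> V \<times> V. of_bool (case x of (a, b, c, d) \<Rightarrow> P a b c d))"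
    using fin by (simp add: of_bool_def sum.If_cases Int_def)
  also have "\<dots> = (\<Sum>a\<in>V. \<Sum>b\<in>V. \<Sum>c\<in>V. \<Sum>d\<in>V. of_bool (P a b c d))"
    by (simp only: sum.cartesian_product') simp
  finally show "real (card {[a, b, c, d] | a b c d. a \<in> V \<and> b \<in> V \<and> c \<in> V \<and> d \<in> V \<and> P a b c d})
      \<le> (\<Sum>a\<in>V. \<Sum>b\<in>V. \<Sum>c\<in>V. \<Sum>d\<in>V. of_bool (P a b c d))"
    unfolding eq using card_image_le[OF fS, of ?h] by simp
qed

lemma card_distinct_lists_le:
  assumes "finite I"
  shows "finite {js. distinct js \<and> set js \<subseteq> I \<and> length js = m}"
    and "card {js. distinct js \<and> set js \<subseteq> I \<and> length js = m} \<le> card I ^ m"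
proof -
  have sub: "{js. distinct js \<and> set js \<subseteq> I \<and> length js = m} \<subseteq> {js. set js \<subseteq> I \<and> length js = m}" by auto
  show "finite {js. distinct js \<and> set js \<subseteq> I \<and> length js = m}"
    using finite_subset[OF sub finite_lists_length_eq[OF assms]] .
  show "card {js. distinct js \<and> set js \<subseteq> I \<and> length js = m} \<le> card I ^ m"
    using card_mono[OF finite_lists_length_eq[OF assms] sub] card_lists_length_eq[OF assms] by simp
qed

text \<open>Fix the rich vertex \<open>v\<close> and fill six slots per colour with random
  neighbours of that colour. The expected number of exceptional triples with \<open>v\<close> and
  exceptional quadruples among the slots is below 1, so some choice meets none and the exact result
  applies to it.\<close>

lemma almost_quadrangle_colouring_power_of_two:
  fixes f :: "'a \<Rightarrow> 'a \<Rightarrow> nat" and \<beta> :: real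
  assumes fin: "finite V" and n: "n = real (card V)" "n > 0" and k: "k > 0" and \<beta>: "\<beta> > 0"
    and sym: "\<And>a b. f a b = f b a" and range: "\<And>a b. f a b < k"
    and bad: "(\<Sum>a\<in>V. \<Sum>b\<in>V. \<Sum>c\<in>V. \<Sum>d\<in>V. of_bool (\<not> good_quadruple f a b c d)) \<le> \<beta> * n ^ 4"
    and same: "(\<Sum>a\<in>V. \<Sum>b\<in>V. \<Sum>c\<in>V. \<Sum>d\<in>V. of_bool (f a b = f c d)) \<le> (1 / real k + \<beta>) * n ^ 4"
    and small: "10 ^ 5 * real k ^ 8 * \<beta> < 1"
  shows "\<exists>p. k = 2 ^ p"
proof -
  have k1: "real k \<ge> 1" using k by simp
  have "256 * real k ^ 5 * \<beta> \<le> 10 ^ 5 * real k ^ 8 * \<beta>"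
    using \<beta> power_increasing[of 5 8 "real k"] k1 by (intro mult_right_mono mult_mono) auto
  then have "256 * real k ^ 5 * \<beta> < 1" using small by linarith
  then obtain v where v: "v \<in> V" and deg: "\<And>i. i < k \<Longrightarrow> real (card {a \<in> V. f v a = i}) \<ge> n / (2 * real k)"
    and bv: "(\<Sum>a\<in>V. \<Sum>b\<in>V. \<Sum>c\<in>V. of_bool (\<not> good_quadruple f v a b c)) \<le> 2 * \<beta> * n ^ 3"
    using exists_rich_vertex[OF fin n k \<beta> range bad same] by blast
  define I where "I = {..<k} \<times> {..<6::nat}"
  define N where "N j = {a \<in> V. f v a = fst j}" for j :: "nat \<times> nat"
  define t where "t = n / (2 * real k)"
  have I: "finite I" "card I = 6 * k" unfolding I_def by auto
  have t: "t > 0" unfolding t_def using n k by auto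
  define L where "L m = {js. distinct js \<and> set js \<subseteq> I \<and> length js = m}" for m
  define B3 where "B3 = {[a, b, c] | a b c. a \<in> V \<and> b \<in> V \<and> c \<in> V \<and> \<not> good_quadruple f v a b c}"
  define B4 where "B4 = {[a, b, c, d] | a b c d. a \<in> V \<and> b \<in> V \<and> c \<in> V \<and> d \<in> V \<and> \<not> good_quadruple f a b c d}"
  define B where "B js = (if length js = 3 then B3 else B4)" for js :: "(nat \<times> nat) list"
  have B3: "finite B3" "real (card B3) \<le> 2 * \<beta> * n ^ 3"
    unfolding B3_def using card_triples_le_sum[OF fin, of "\<lambda>a b c. \<not> good_quadruple f v a b c"] bv by simp_all
  have B4: "finite B4" "real (card B4) \<le> \<beta> * n ^ 4"
    unfolding B4_def using card_quadruples_le_sum[OF fin, of "\<lambda>a b c d. \<not> good_quadruple f a b c d"] bad by simp_all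
  have L: "finite (L m)" "real (card (L m)) \<le> (6 * real k) ^ m" for m
    using card_distinct_lists_le[OF I(1), of m] unfolding L_def I(2)
    by (simp_all flip: of_nat_le_iff[where 'a = real])
  have "\<exists>\<phi>. (\<forall>i\<in>I. \<phi> i \<in> N i) \<and> (\<forall>js\<in>L 3 \<union> L 4. map \<phi> js \<notin> B js)"
  proof (rule union_bound_choice[OF I(1) _ _ t])
    show "finite (N i)" for i unfolding N_def using fin by simp
    show "t \<le> real (card (N i))" if "i \<in> I" for i
      unfolding N_def t_def using deg[of "fst i"] that I_def by auto
    show "finite (L 3 \<union> L 4)" using L by simp
    show "distinct js \<and> set js \<subseteq> I \<and> finite (B js)" if "js \<in> L 3 \<union> L 4" for js
      using that B3(1) B4(1) unfolding L_def B_def by auto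
    have "(\<Sum>js\<in>L 3 \<union> L 4. real (card (B js)) / t ^ length js)
      = (\<Sum>js\<in>L 3. real (card (B js)) / t ^ length js) + (\<Sum>js\<in>L 4. real (card (B js)) / t ^ length js)"
      using L(1) by (intro sum.union_disjoint) (auto simp: L_def)
    also have "\<dots> = (\<Sum>js\<in>L 3. real (card B3) / t ^ 3) + (\<Sum>js\<in>L 4. real (card B4) / t ^ 4)"
      by (intro arg_cong2[where f = "(+)"] sum.cong refl) (auto simp: L_def B_def)
    also have "\<dots> = real (card (L 3)) * (real (card B3) / t ^ 3) + real (card (L 4)) * (real (card B4) / t ^ 4)"
      by simp
    also have "\<dots> \<le> (6 * real k) ^ 3 * (2 * \<beta> * n ^ 3 / t ^ 3) + (6 * real k) ^ 4 * (\<beta> * n ^ 4 / t ^ 4)"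
      using L(2)[of 3] L(2)[of 4] B3(2) B4(2) t by (intro add_mono mult_mono divide_right_mono) auto
    \<comment> \<open>As \<open>n / t = 2 * k\<close>, the constants are
      \<open>2 * 6 ^ 3 * 2 ^ 3\<close> and \<open>6 ^ 4 * 2 ^ 4\<close>; their sum is below
      \<open>10 ^ 5\<close>.\<close>
    also have "\<dots> = 3456 * real k ^ 6 * \<beta> + 20736 * real k ^ 8 * \<beta>"
      unfolding t_def using n k by (simp add: field_simps eval_nat_numeral)
    also have "\<dots> \<le> 3456 * real k ^ 8 * \<beta> + 20736 * real k ^ 8 * \<beta>"
      using \<beta> power_increasing[of 6 8 "real k"] k1 by (intro add_mono mult_right_mono mult_mono) auto
    also have "\<dots> \<le> 10 ^ 5 * real k ^ 8 * \<beta>" using \<beta> k1 by simp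
    also have "\<dots> < 1" by (rule small)
    finally show "(\<Sum>js\<in>L 3 \<union> L 4. real (card (B js)) / t ^ length js) < 1" .
  qed
  then obtain \<phi> where \<phi>: "\<And>i. i \<in> I \<Longrightarrow> \<phi> i \<in> N i" and nb: "\<And>js. js \<in> L 3 \<union> L 4 \<Longrightarrow> map \<phi> js \<notin> B js"
    by blast
  have \<phi>V: "\<phi> i \<in> V" "f v (\<phi> i) = fst i" if "i \<in> I" for i using \<phi>[OF that] unfolding N_def by auto
  have g3: "good_quadruple f v (\<phi> i) (\<phi> j) (\<phi> l)" if "{i,j,l} \<subseteq> I" "distinct [i,j,l]" for i j l
  proof -
    have "[i,j,l] \<in> L 3 \<union> L 4" using that unfolding L_def by auto
    then show ?thesis using nb[of "[i,j,l]"] that \<phi>V unfolding B_def B3_def by auto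
  qed
  have g4: "good_quadruple f (\<phi> i) (\<phi> j) (\<phi> l) (\<phi> m)" if "{i,j,l,m} \<subseteq> I" "distinct [i,j,l,m]" for i j l m
  proof -
    have "[i,j,l,m] \<in> L 3 \<union> L 4" using that unfolding L_def by auto
    then show ?thesis using nb[of "[i,j,l,m]"] that \<phi>V unfolding B_def B4_def by auto
  qed
  have third: "\<exists>l\<in>I. l \<noteq> i \<and> l \<noteq> j" for i j
  proof -
    have "card {i, j} < card I" unfolding I(2) using k by (auto simp: card_insert_if)
    then show ?thesis using obtain_notin[of "{i,j}" I] by auto
  qed
  \<comment> \<open>Distinctness is part of \<open>good_quadruple\<close>, so two indices only have
    to be completed to a triple. The same argument separates \<open>v\<close> from the chosen
    vertices.\<close>
  have inj: "inj_on \<phi> I"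
  proof (rule inj_onI, rule ccontr)
    fix i j assume ij: "i \<in> I" "j \<in> I" "\<phi> i = \<phi> j" "i \<noteq> j"
    obtain l where "l \<in> I" "l \<noteq> i" "l \<noteq> j" using third by blast
    then show False using g3[of i j l] ij unfolding good_quadruple_def by auto
  qed
  have vA: "v \<notin> \<phi> ` I"
  proof
    assume "v \<in> \<phi> ` I"
    then obtain i where i: "i \<in> I" "v = \<phi> i" by blast
    obtain j where j: "j \<in> I" "j \<noteq> i" using third by blast
    obtain l where "l \<in> I" "l \<noteq> i" "l \<noteq> j" using third by blast
    then show False using g3[of i j l] i j unfolding good_quadruple_def by auto
  qed
  have gv: "f v b = f c d \<longleftrightarrow> f v c = f b d" if bcd: "{b,c,d} \<subseteq> \<phi> ` I" "distinct [b,c,d]" for b c d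
  proof -
    obtain i where i: "i \<in> I" "b = \<phi> i" using bcd(1) by auto
    obtain j where j: "j \<in> I" "c = \<phi> j" using bcd(1) by auto
    obtain l where "l \<in> I" "d = \<phi> l" using bcd(1) by auto
    with i j show ?thesis using g3[of i j l] bcd(2) unfolding good_quadruple_def by auto
  qed
  show ?thesis
  proof (rule quadrangle_colouring_power_of_two[OF k sym range vA])
    show "card {a \<in> \<phi> ` I. f v a = i} \<ge> 6" if "i < k" for i
    proof -
      have sub: "{i} \<times> {..<6} \<subseteq> I" unfolding I_def using that by auto
      have "card (\<phi> ` ({i} \<times> {..<6})) = 6"
        using card_image[OF inj_on_subset[OF inj sub]] by simp
      moreover have "\<phi> ` ({i} \<times> {..<6}) \<subseteq> {a \<in> \<phi> ` I. f v a = i}"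
      proof (rule image_subsetI)
        fix j assume j: "j \<in> {i} \<times> {..<6::nat}"
        then have "j \<in> I" "fst j = i" using sub by auto
        then show "\<phi> j \<in> {a \<in> \<phi> ` I. f v a = i}" using \<phi>V(2)[of j] by simp
      qed
      moreover have "finite {a \<in> \<phi> ` I. f v a = i}" using I(1) by simp
      ultimately show ?thesis using card_mono by metis
    qed
    show "f a c = f b d" if h: "{a, b, c, d} \<subseteq> insert v (\<phi> ` I)" "distinct [a, b, c, d]" "f a b = f c d" for a b c d
    proof -
      \<comment> \<open>\<open>gv\<close> treats \<open>v\<close> in the first position only; the
        symmetry of \<open>f\<close> moves it there from any other position.\<close>
      consider "a = v" | "b = v" | "c = v" | "d = v" | "{a,b,c,d} \<subseteq> \<phi> ` I" using h(1) by blast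
      then show ?thesis
      proof cases
        case 1
        then show ?thesis using gv[of b c d] h by auto
      next
        case 2
        then show ?thesis using gv[of a d c] h sym[of a v] sym[of c d] by auto
      next
        case 3
        then show ?thesis using gv[of d a b] h sym[of a v] sym[of b d] by auto
      next
        case 4
        then show ?thesis using gv[of c b a] h sym[of c v] sym[of b v] sym[of a b] sym[of a c] by auto
      next
        case 5
        obtain i where i: "i \<in> I" "a = \<phi> i" using 5 by auto
        obtain j where j: "j \<in> I" "b = \<phi> j" using 5 by auto
        obtain l where l: "l \<in> I" "c = \<phi> l" using 5 by auto
        obtain m where "m \<in> I" "d = \<phi> m" using 5 by auto
        with i j l show ?thesis using g4[of i j l m] h(2,3) unfolding good_quadruple_def by auto
      qed
    qed
  qed
qed

subsection \<open>The graph of pairs\<close>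

text \<open>
  Fueredi's argument: the non-neighbourhood of a vertex of maximum degree becomes a colour class,
  and one continues inside its neighbourhood. Edges are counted as ordered pairs.
\<close>

lemma clique_free_stable_colouring:
  fixes adj :: "'b \<Rightarrow> 'b \<Rightarrow> bool"
  assumes "finite W" and sym: "\<And>x y. adj x y \<Longrightarrow> adj y x" and irr: "\<And>x. \<not> adj x x"
    and "\<not> (\<exists>K\<subseteq>W. card K = Suc k \<and> (\<forall>x\<in>K. \<forall>y\<in>K. x \<noteq> y \<longrightarrow> adj x y))"
  shows "\<exists>col. (\<forall>x\<in>W. col x < k) \<and>
    (\<Sum>x\<in>W. \<Sum>y\<in>W. of_bool (adj x y)) + (\<Sum>x\<in>W. \<Sum>y\<in>W. of_bool (adj x y \<and> col x = col y))
      \<le> (\<Sum>x\<in>W. \<Sum>y\<in>W. of_bool (col x \<noteq> col y) :: nat)"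
  using assms(1,4)
proof (induction k arbitrary: W)
  case 0
  have "W = {}"
  proof (rule ccontr)
    assume "W \<noteq> {}"
    then obtain w where "w \<in> W" by blast
    then have "{w} \<subseteq> W \<and> card {w} = Suc 0 \<and> (\<forall>x\<in>{w}. \<forall>y\<in>{w}. x \<noteq> y \<longrightarrow> adj x y)" by auto
    then show False using 0 by blast
  qed
  then show ?case by simp
next
  case (Suc k)
  show ?case
  proof (cases "W = {}")
    case False
    define nb where "nb x = {y \<in> W. adj x y}" for x
    obtain x where x: "x \<in> W" and mx: "\<And>y. y \<in> W \<Longrightarrow> card (nb y) \<le> card (nb x)"
      using obtains_MAX[OF Suc.prems(1) False, of "\<lambda>y. card (nb y)"] Suc.prems(1)
      by (metis Max_ge finite_imageI imageI)
    define U where "U = nb x"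
    define R where "R = W - U"
    have UW: "U \<subseteq> W" unfolding U_def nb_def by auto
    have fU: "finite U" and fR: "finite R" using UW Suc.prems(1) finite_subset R_def by auto
    have W: "W = U \<union> R" "U \<inter> R = {}" using UW R_def by auto
    have "\<not> (\<exists>K\<subseteq>U. card K = Suc k \<and> (\<forall>x\<in>K. \<forall>y\<in>K. x \<noteq> y \<longrightarrow> adj x y))"
    proof
      assume "\<exists>K\<subseteq>U. card K = Suc k \<and> (\<forall>x\<in>K. \<forall>y\<in>K. x \<noteq> y \<longrightarrow> adj x y)"
      then obtain K where K: "K \<subseteq> U" "card K = Suc k" "\<forall>x\<in>K. \<forall>y\<in>K. x \<noteq> y \<longrightarrow> adj x y" by blast
      have xK: "\<And>y. y \<in> K \<Longrightarrow> adj x y" using K(1) unfolding U_def nb_def by auto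
      then have "x \<notin> K" using irr by blast
      then have "card (insert x K) = Suc (Suc k)" using K fU finite_subset by (metis card_insert_disjoint)
      moreover have "insert x K \<subseteq> W" using K UW x by auto
      moreover have "\<forall>a\<in>insert x K. \<forall>b\<in>insert x K. a \<noteq> b \<longrightarrow> adj a b" using K(3) xK sym by blast
      ultimately show False using Suc.prems(2) by blast
    qed
    then obtain col where col: "\<forall>x\<in>U. col x < k" and le:
      "(\<Sum>x\<in>U. \<Sum>y\<in>U. of_bool (adj x y)) + (\<Sum>x\<in>U. \<Sum>y\<in>U. of_bool (adj x y \<and> col x = col y))
      \<le> (\<Sum>x\<in>U. \<Sum>y\<in>U. of_bool (col x \<noteq> col y) :: nat)"
      using Suc.IH[OF fU] by blast
    \<comment> \<open>The class \<open>R\<close> that receives the new colour \<open>k\<close>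
      contains \<open>x\<close> itself, since \<open>x\<close> is not its own neighbour.\<close>
    define c where "c y = (if y \<in> U then col y else k)" for y
    have split: "(\<Sum>x\<in>W. \<Sum>y\<in>W. g x y) = (\<Sum>x\<in>U. \<Sum>y\<in>U. g x y) + (\<Sum>x\<in>U. \<Sum>y\<in>R. g x y)
        + (\<Sum>x\<in>R. \<Sum>y\<in>U. g x y) + (\<Sum>x\<in>R. \<Sum>y\<in>R. g x y)" for g :: "'b \<Rightarrow> 'b \<Rightarrow> nat"
      unfolding W(1) using fU fR W(2) by (simp add: sum.union_disjoint sum.distrib)
    have cU: "\<And>y. y \<in> U \<Longrightarrow> c y = col y" and cR: "\<And>y. y \<in> R \<Longrightarrow> c y = k"
      unfolding c_def R_def by auto
    have ne: "\<And>y z. y \<in> U \<Longrightarrow> z \<in> R \<Longrightarrow> c y \<noteq> c z" using cU cR col by fastforce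
    let ?UR = "(\<Sum>x\<in>U. \<Sum>y\<in>R. of_bool (adj x y)) :: nat"
    let ?RU = "(\<Sum>x\<in>R. \<Sum>y\<in>U. of_bool (adj x y)) :: nat"
    let ?RR = "(\<Sum>x\<in>R. \<Sum>y\<in>R. of_bool (adj x y)) :: nat"
    have "?UR = (\<Sum>y\<in>R. \<Sum>x\<in>U. of_bool (adj x y))" by (rule sum.swap)
    also have "\<dots> = ?RU" by (intro sum.cong refl arg_cong[where f = of_bool]) (metis sym)
    finally have UR: "?UR = ?RU" .
    \<comment> \<open>This is the sum of the degrees over \<open>R\<close>, each at most
      \<open>card U\<close> by the choice of \<open>x\<close>. Passing from \<open>U\<close> to
      \<open>W\<close> raises the left side of the claim by \<open>?UR + ?RU + 2 * ?RR\<close>,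
      twice this sum, and the right side by \<open>2 * (card R * card U)\<close>.\<close>
    have "?RU + ?RR = (\<Sum>x\<in>R. \<Sum>y\<in>W. of_bool (adj x y))"
      unfolding W(1) sum.union_disjoint[OF fU fR W(2)] by (simp only: sum.distrib)
    also have "\<dots> = (\<Sum>x\<in>R. card (nb x))"
      unfolding nb_def using Suc.prems(1) by (simp add: of_bool_def sum.If_cases Int_def)
    also have "\<dots> \<le> (\<Sum>x\<in>R. card U)"
      unfolding U_def using mx R_def by (intro sum_mono) auto
    finally have RR: "?RU + ?RR \<le> card R * card U" by simp
    have adjs: "(\<Sum>x\<in>W. \<Sum>y\<in>W. of_bool (adj x y) :: nat)
       = (\<Sum>x\<in>U. \<Sum>y\<in>U. of_bool (adj x y)) + ?UR + ?RU + ?RR" by (rule split)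
    have same: "(\<Sum>x\<in>W. \<Sum>y\<in>W. of_bool (adj x y \<and> c x = c y) :: nat)
       = (\<Sum>x\<in>U. \<Sum>y\<in>U. of_bool (adj x y \<and> col x = col y)) + ?RR"
    proof -
      have "(\<Sum>x\<in>U. \<Sum>y\<in>U. of_bool (adj x y \<and> c x = c y) :: nat) = (\<Sum>x\<in>U. \<Sum>y\<in>U. of_bool (adj x y \<and> col x = col y))"
        by (intro sum.cong refl) (simp add: cU)
      moreover have "(\<Sum>x\<in>U. \<Sum>y\<in>R. of_bool (adj x y \<and> c x = c y) :: nat) = 0"
        using ne by (intro sum.neutral ballI) auto
      moreover have "(\<Sum>x\<in>R. \<Sum>y\<in>U. of_bool (adj x y \<and> c x = c y) :: nat) = 0"
        using ne by (intro sum.neutral ballI) fastforce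
      moreover have "(\<Sum>x\<in>R. \<Sum>y\<in>R. of_bool (adj x y \<and> c x = c y) :: nat) = ?RR"
        by (intro sum.cong refl) (simp add: cR)
      ultimately show ?thesis unfolding split by simp
    qed
    have diff: "(\<Sum>x\<in>W. \<Sum>y\<in>W. of_bool (c x \<noteq> c y) :: nat)
       = (\<Sum>x\<in>U. \<Sum>y\<in>U. of_bool (col x \<noteq> col y)) + 2 * (card R * card U)"
    proof -
      have "(\<Sum>x\<in>U. \<Sum>y\<in>U. of_bool (c x \<noteq> c y) :: nat) = (\<Sum>x\<in>U. \<Sum>y\<in>U. of_bool (col x \<noteq> col y))"
        by (intro sum.cong refl) (simp add: cU)
      moreover have "(\<Sum>x\<in>U. \<Sum>y\<in>R. of_bool (c x \<noteq> c y) :: nat) = (\<Sum>x\<in>U. \<Sum>y\<in>R. 1)"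
        using ne by (intro sum.cong refl) auto
      moreover have "(\<Sum>x\<in>R. \<Sum>y\<in>U. of_bool (c x \<noteq> c y) :: nat) = (\<Sum>x\<in>R. \<Sum>y\<in>U. 1)"
        using ne by (intro sum.cong refl) fastforce
      moreover have "(\<Sum>x\<in>R. \<Sum>y\<in>R. of_bool (c x \<noteq> c y) :: nat) = 0"
        by (intro sum.neutral ballI) (simp add: cR)
      ultimately show ?thesis unfolding split by simp
    qed
    have "(\<forall>x\<in>W. c x < Suc k)" using col c_def by (auto simp: less_SucI)
    moreover have "(\<Sum>x\<in>W. \<Sum>y\<in>W. of_bool (adj x y)) + (\<Sum>x\<in>W. \<Sum>y\<in>W. of_bool (adj x y \<and> c x = c y))
      \<le> (\<Sum>x\<in>W. \<Sum>y\<in>W. of_bool (c x \<noteq> c y) :: nat)"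
      unfolding adjs same diff using le RR UR by linarith
    ultimately show ?thesis by blast
  qed simp
qed

section \<open>Translating between vertices, pairs and edges\<close>

definition pairs :: "'a set \<Rightarrow> 'a set set" where
  "pairs V = {P. P \<subseteq> V \<and> card P = 2}"

definition pair_adj :: "'a set set \<Rightarrow> 'a set \<Rightarrow> 'a set \<Rightarrow> bool" where
  "pair_adj E P Q \<longleftrightarrow> P \<inter> Q = {} \<and> P \<union> Q \<in> E"

lemma finite_pairs: "finite V \<Longrightarrow> finite (pairs V)"
  unfolding pairs_def by simp

lemma card_pairs: "finite V \<Longrightarrow> card (pairs V) = card V choose 2"
  unfolding pairs_def by (rule n_subsets)

text \<open>Every pair comes from two ordered pairs of vertices. Applied twice, this converts counts
  in the graph of pairs into counts of quadruples, with a factor 4.\<close>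

lemma sum_ordered_pairs:
  fixes g :: "'a set \<Rightarrow> real"
  assumes "finite V"
  shows "(\<Sum>a\<in>V. \<Sum>b\<in>V. of_bool (a \<noteq> b) * g {a, b}) = 2 * (\<Sum>P\<in>pairs V. g P)"
proof -
  define T where "T = {x \<in> V \<times> V. fst x \<noteq> snd x}"
  define h where "h x = {fst x, snd x}" for x :: "'a \<times> 'a"
  have fT: "finite T" unfolding T_def using assms by auto
  have "(\<Sum>a\<in>V. \<Sum>b\<in>V. of_bool (a \<noteq> b) * g {a, b}) = (\<Sum>x\<in>V \<times> V. of_bool (fst x \<noteq> snd x) * g (h x))"
    unfolding h_def by (simp add: sum.cartesian_product case_prod_beta)
  also have "\<dots> = (\<Sum>x\<in>T. g (h x))"
    unfolding T_def using assms by (intro sum.mono_neutral_cong_right) auto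
  also have "\<dots> = (\<Sum>P\<in>pairs V. \<Sum>x\<in>{x \<in> T. h x = P}. g (h x))"
  proof -
    have "h ` T \<subseteq> pairs V" unfolding T_def h_def pairs_def by auto
    then show ?thesis using sum.group[OF fT finite_pairs[OF assms], of h "\<lambda>x. g (h x)"] by simp
  qed
  also have "\<dots> = (\<Sum>P\<in>pairs V. 2 * g P)"
  proof (intro sum.cong refl)
    fix P assume "P \<in> pairs V"
    then obtain a b where ab: "P = {a, b}" "a \<noteq> b" "a \<in> V" "b \<in> V"
      unfolding pairs_def by (auto simp: card_2_iff)
    have "{x \<in> T. h x = P} = {(a, b), (b, a)}"
      using ab unfolding T_def h_def by (auto simp: doubleton_eq_iff)
    moreover have "h (a, b) = P" "h (b, a) = P" using ab unfolding h_def by auto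
    ultimately show "(\<Sum>x\<in>{x \<in> T. h x = P}. g (h x)) = 2 * g P" using ab(2) by simp
  qed
  also have "\<dots> = 2 * (\<Sum>P\<in>pairs V. g P)" by (simp only: sum_distrib_left)
  finally show ?thesis .
qed

lemma sum_ordered_pair_pairs:
  fixes g :: "'a set \<Rightarrow> 'a set \<Rightarrow> real"
  assumes "finite V"
  shows "(\<Sum>a\<in>V. \<Sum>b\<in>V. \<Sum>c\<in>V. \<Sum>d\<in>V. of_bool (a \<noteq> b) * (of_bool (c \<noteq> d) * g {a, b} {c, d}))
    = 4 * (\<Sum>P\<in>pairs V. \<Sum>Q\<in>pairs V. g P Q)"
proof -
  have "(\<Sum>a\<in>V. \<Sum>b\<in>V. \<Sum>c\<in>V. \<Sum>d\<in>V. of_bool (a \<noteq> b) * (of_bool (c \<noteq> d) * g {a, b} {c, d}))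
    = (\<Sum>a\<in>V. \<Sum>b\<in>V. of_bool (a \<noteq> b) * (2 * (\<Sum>Q\<in>pairs V. g {a, b} Q)))"
    by (simp only: sum_distrib_left[symmetric] sum_ordered_pairs[OF assms])
  also have "\<dots> = 2 * (\<Sum>P\<in>pairs V. 2 * (\<Sum>Q\<in>pairs V. g P Q))"
    by (rule sum_ordered_pairs[OF assms])
  also have "\<dots> = 4 * (\<Sum>P\<in>pairs V. \<Sum>Q\<in>pairs V. g P Q)" by (simp flip: sum_distrib_left)
  finally show ?thesis .
qed

text \<open>Each edge \<open>e\<close> has six subsets \<open>P\<close> of size 2, and each gives an
  ordered adjacency between \<open>P\<close> and \<open>e - P\<close>; the edge is recovered as
  their union.\<close>

lemma pair_adj_count:
  assumes "uniform4_hypergraph V E"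
  shows "6 * card E \<le> (\<Sum>P\<in>pairs V. \<Sum>Q\<in>pairs V. of_bool (pair_adj E P Q))"
proof -
  have V: "finite V" and E: "\<And>e. e \<in> E \<Longrightarrow> e \<subseteq> V \<and> card e = 4"
    using assms unfolding uniform4_hypergraph_def by auto
  have fe: "finite e" if "e \<in> E" for e using E[OF that] V finite_subset by auto
  have fE: "finite E" using E V by (meson Pow_iff finite_Pow_iff finite_subset subsetI)
  let ?S = "{x \<in> pairs V \<times> pairs V. pair_adj E (fst x) (snd x)}"
  have six: "card (pairs e) = 6" if "e \<in> E" for e
    using card_pairs[OF fe[OF that]] E[OF that] by (simp add: numeral_eq_Suc)
  have "card (Sigma E pairs) = (\<Sum>e\<in>E. card (pairs e))"
    using fE fe finite_pairs by (intro card_SigmaI) auto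
  also have "\<dots> = 6 * card E" using six by simp
  finally have "6 * card E = card (Sigma E pairs)" by simp
  also have "\<dots> \<le> card ?S"
  proof (rule card_inj_on_le)
    show "inj_on (\<lambda>(e, P). (P, e - P)) (Sigma E pairs)"
      unfolding pairs_def by (rule inj_onI) auto
    show "(\<lambda>(e, P). (P, e - P)) ` Sigma E pairs \<subseteq> ?S"
    proof
      fix z assume "z \<in> (\<lambda>(e, P). (P, e - P)) ` Sigma E pairs"
      then obtain e P where z: "z = (P, e - P)" and a: "e \<in> E" "P \<in> pairs e" by auto
      then have P: "P \<subseteq> e" "card P = 2" "P \<union> (e - P) = e" unfolding pairs_def by auto
      have "card (e - P) = 2" using card_Diff_subset[of P e] P E[OF a(1)] fe[OF a(1)] finite_subset by fastforce
      then show "z \<in> ?S"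
        using z P a E[OF a(1)] unfolding pairs_def pair_adj_def by auto
    qed
    show "finite ?S" using finite_pairs[OF V] by auto
  qed
  also have "\<dots> = (\<Sum>x\<in>pairs V \<times> pairs V. of_bool (pair_adj E (fst x) (snd x)))"
    using finite_pairs[OF V] by (simp add: of_bool_def sum.If_cases Int_def)
  also have "\<dots> = (\<Sum>P\<in>pairs V. \<Sum>Q\<in>pairs V. of_bool (pair_adj E P Q))"
    by (simp only: sum.cartesian_product') simp
  finally show ?thesis .
qed

text \<open>The two vertices over \<open>i\<close> go to the two elements of the \<open>i\<close>-th
  pair of the clique. Adjacent pairs are disjoint, which makes the map injective.\<close>

lemma contains_C4_if_clique:
  assumes K: "K \<subseteq> pairs V" "card K = r" "r > 0"
    and cl: "\<And>P Q. P \<in> K \<Longrightarrow> Q \<in> K \<Longrightarrow> P \<noteq> Q \<Longrightarrow> pair_adj E P Q"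
  shows "contains_C4 r V E"
proof -
  have "finite K" using K(2,3) card_ge_0_finite by blast
  then obtain g where g: "bij_betw g {0..<r} K" using ex_bij_betw_nat_finite K(2) by blast
  have gK: "g i \<in> K" if "i < r" for i using bij_betwE[OF g] that by auto
  have ginj: "g i = g j \<longleftrightarrow> i = j" if "i < r" "j < r" for i j
    using bij_betw_imp_inj_on[OF g] that by (auto dest: inj_onD)
  have "\<forall>i. \<exists>x y. i < r \<longrightarrow> g i = {x, y} \<and> x \<noteq> y"
  proof
    fix i
    have "\<exists>x y. g i = {x, y} \<and> x \<noteq> y" if "i < r"
      using gK[OF that] K(1) unfolding pairs_def by (auto simp: card_2_iff)
    then show "\<exists>x y. i < r \<longrightarrow> g i = {x, y} \<and> x \<noteq> y" by blast
  qed
  then obtain x y where xy: "\<And>i. i < r \<Longrightarrow> g i = {x i, y i} \<and> x i \<noteq> y i" by metis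
  define f where "f p = (if snd p = 0 then x (fst p) else y (fst p))" for p :: "nat \<times> nat"
  have fg: "f p \<in> g (fst p)" if "fst p < r" for p using xy[OF that] unfolding f_def by auto
  have im: "f ` C4_pair i = g i" if "i < r" for i
    using xy[OF that] unfolding C4_pair_def f_def by auto
  show ?thesis unfolding contains_C4_def
  proof (intro exI conjI ballI)
    show "inj_on f (C4_vertices r)"
    proof (rule inj_onI)
      fix p q assume a: "p \<in> C4_vertices r" "q \<in> C4_vertices r" "f p = f q"
      then have lt: "fst p < r" "fst q < r" "snd p < 2" "snd q < 2" unfolding C4_vertices_def by auto
      have "fst p = fst q"
      proof (rule ccontr)
        assume "fst p \<noteq> fst q"
        then have "pair_adj E (g (fst p)) (g (fst q))" using cl gK ginj lt by auto
        then show False using fg lt a(3) unfolding pair_adj_def by (metis IntI empty_iff)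
      qed
      moreover have "snd p = snd q"
        using a(3) xy[OF lt(1)] lt calculation unfolding f_def by (auto split: if_splits)
      ultimately show "p = q" by (rule prod_eqI)
    qed
    show "f ` C4_vertices r \<subseteq> V"
    proof clarify
      fix i j assume "(i, j) \<in> C4_vertices r"
      then have i: "i < r" unfolding C4_vertices_def by auto
      then have "g i \<subseteq> V" using gK K(1) unfolding pairs_def by auto
      then show "f (i, j) \<in> V" using fg[of "(i, j)"] i by auto
    qed
    fix e assume "e \<in> C4_edges r"
    then obtain i j where ij: "e = C4_pair i \<union> C4_pair j" "i < r" "j < r" "i \<noteq> j" unfolding C4_edges_def by auto
    have "f ` e = g i \<union> g j" unfolding ij(1) image_Un using im ij by simp
    moreover have "pair_adj E (g i) (g j)" using cl gK ginj ij by auto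
    ultimately show "f ` e \<in> E" unfolding pair_adj_def by simp
  qed
qed

section \<open>From the hypergraph to an almost quadrangle colouring\<close>

lemma sum_not_distinct4_le:
  assumes "finite V"
  shows "(\<Sum>a\<in>V. \<Sum>b\<in>V. \<Sum>c\<in>V. \<Sum>d\<in>V. of_bool (\<not> distinct [a, b, c, d])) \<le> 6 * real (card V) ^ 3"
proof -
  have one: "(\<Sum>b\<in>V. of_bool (a = b) :: real) = 1" if "a \<in> V" for a
    using that assms by (simp add: of_bool_def)
  have "(\<Sum>a\<in>V. \<Sum>b\<in>V. \<Sum>c\<in>V. \<Sum>d\<in>V. of_bool (\<not> distinct [a, b, c, d]) :: real)
    \<le> (\<Sum>a\<in>V. \<Sum>b\<in>V. \<Sum>c\<in>V. \<Sum>d\<in>V. of_bool (a = b) + of_bool (a = c) + of_bool (a = d)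
        + of_bool (b = c) + of_bool (b = d) + of_bool (c = d))"
    by (intro sum_mono) auto
  also have "\<dots> = 6 * real (card V) ^ 3"
    by (simp add: sum.distrib one eval_nat_numeral cong: sum.cong flip: sum_distrib_left)
  finally show ?thesis .
qed

text \<open>With \<open>N\<close> pairs in all, \<open>\<Delta>\<close> is the gap between the Turan
  bound \<open>N\<^sup>2 - N\<^sup>2 / k\<close> on ordered adjacencies and the
  \<open>6 * card E\<close> adjacencies known to exist. Stability bounds all errors by multiples of
  \<open>\<Delta>\<close>; the terms in \<open>n ^ 3\<close> absorb degenerate quadruples.\<close>

lemma exists_almost_quadrangle_colouring:
  fixes V :: "'a set"
  assumes H: "uniform4_hypergraph V E" and k: "k > 0" and free: "\<not> contains_C4 (Suc k) V E"
    and n: "n = real (card V)"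
    and \<Delta>: "\<Delta> = (real (card V choose 2))\<^sup>2 - (real (card V choose 2))\<^sup>2 / real k - 6 * real (card E)"
  shows "\<exists>f :: 'a \<Rightarrow> 'a \<Rightarrow> nat. (\<forall>a b. f a b = f b a) \<and> (\<forall>a b. f a b < k) \<and>
    (\<Sum>a\<in>V. \<Sum>b\<in>V. \<Sum>c\<in>V. \<Sum>d\<in>V. of_bool (\<not> good_quadruple f a b c d)) \<le> 6 * n ^ 3 + 24 * \<Delta> \<and>
    (\<Sum>a\<in>V. \<Sum>b\<in>V. \<Sum>c\<in>V. \<Sum>d\<in>V. of_bool (f a b = f c d))
      \<le> 2 * n ^ 3 + 4 * ((real (card V choose 2))\<^sup>2 / real k + \<Delta>)"
proof -
  have V: "finite V" using H unfolding uniform4_hypergraph_def by auto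
  define W where "W = pairs V"
  define N where "N = real (card V choose 2)"
  have fW: "finite W" and cW: "real (card W) = N"
    unfolding W_def N_def using finite_pairs[OF V] card_pairs[OF V] by auto
  have noK: "\<not> (\<exists>K\<subseteq>W. card K = Suc k \<and> (\<forall>P\<in>K. \<forall>Q\<in>K. P \<noteq> Q \<longrightarrow> pair_adj E P Q))"
  proof
    assume "\<exists>K\<subseteq>W. card K = Suc k \<and> (\<forall>P\<in>K. \<forall>Q\<in>K. P \<noteq> Q \<longrightarrow> pair_adj E P Q)"
    then obtain K where "K \<subseteq> pairs V" "card K = Suc k" "\<forall>P\<in>K. \<forall>Q\<in>K. P \<noteq> Q \<longrightarrow> pair_adj E P Q"
      unfolding W_def by blast
    then have "contains_C4 (Suc k) V E" by (intro contains_C4_if_clique[of K]) auto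
    then show False using free by simp
  qed
  have irr: "\<not> pair_adj E P P" for P
    using H unfolding pair_adj_def uniform4_hypergraph_def by auto
  have syma: "pair_adj E P Q \<Longrightarrow> pair_adj E Q P" for P Q
    unfolding pair_adj_def by (simp add: Int_commute Un_commute)
  obtain col0 where col0: "\<forall>P\<in>W. col0 P < k" and le0:
    "(\<Sum>P\<in>W. \<Sum>Q\<in>W. of_bool (pair_adj E P Q)) + (\<Sum>P\<in>W. \<Sum>Q\<in>W. of_bool (pair_adj E P Q \<and> col0 P = col0 Q))
      \<le> (\<Sum>P\<in>W. \<Sum>Q\<in>W. of_bool (col0 P \<noteq> col0 Q) :: nat)"
    using clique_free_stable_colouring[OF fW syma irr noK] by blast
  \<comment> \<open>The default 0 covers singletons, so that \<open>f a a\<close> is a colour below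
    \<open>k\<close> too.\<close>
  define col where "col P = (if P \<in> W then col0 P else 0)" for P
  have colk: "col P < k" for P unfolding col_def using col0 k by auto
  define adj where "adj = (\<Sum>P\<in>W. \<Sum>Q\<in>W. of_bool (pair_adj E P Q) :: real)"
  define asm where "asm = (\<Sum>P\<in>W. \<Sum>Q\<in>W. of_bool (pair_adj E P Q \<and> col P = col Q) :: real)"
  define dif where "dif = (\<Sum>P\<in>W. \<Sum>Q\<in>W. of_bool (col P \<noteq> col Q) :: real)"
  define sam where "sam = (\<Sum>P\<in>W. \<Sum>Q\<in>W. of_bool (col P = col Q) :: real)"
  define wrg where "wrg = (\<Sum>P\<in>W. \<Sum>Q\<in>W. of_bool (pair_adj E P Q \<longleftrightarrow> col P = col Q) :: real)"
  have "adj + asm = real ((\<Sum>P\<in>W. \<Sum>Q\<in>W. of_bool (pair_adj E P Q))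
      + (\<Sum>P\<in>W. \<Sum>Q\<in>W. of_bool (pair_adj E P Q \<and> col0 P = col0 Q)))"
    unfolding adj_def asm_def col_def by (simp del: sum_of_bool_eq cong: sum.cong)
  also have "\<dots> \<le> real (\<Sum>P\<in>W. \<Sum>Q\<in>W. of_bool (col0 P \<noteq> col0 Q))" using le0 of_nat_le_iff by blast
  also have "\<dots> = dif" unfolding dif_def col_def by (simp del: sum_of_bool_eq cong: sum.cong)
  finally have stab: "adj + asm \<le> dif" .
  have adjE: "6 * real (card E) \<le> adj"
  proof -
    have "real (6 * card E) \<le> real (\<Sum>P\<in>W. \<Sum>Q\<in>W. of_bool (pair_adj E P Q))"
      unfolding W_def using pair_adj_count[OF H] of_nat_le_iff by blast
    then show ?thesis unfolding adj_def by (simp del: sum_of_bool_eq)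
  qed
  have asm0: "asm \<ge> 0" unfolding asm_def by (intro sum_nonneg) simp
  have "sam + dif = (\<Sum>P\<in>W. \<Sum>Q\<in>W. 1)"
    unfolding sam_def dif_def sum.distrib[symmetric] by (intro sum.cong refl) simp
  then have total: "sam + dif = N\<^sup>2" using cW by (simp add: power2_eq_square)
  \<comment> \<open>Cauchy-Schwarz for the sizes \<open>z i\<close> of the \<open>k\<close> colour
    classes.\<close>
  have "sam \<ge> N\<^sup>2 / real k"
  proof -
    have one: "(\<Sum>i<k. of_bool (col P = i) * h i) = h (col P)" for P and h :: "nat \<Rightarrow> real"
      using colk[of P] by (simp add: of_bool_def if_distrib[where f = "\<lambda>y. y * _"] cong: if_cong)
    define z where "z i = (\<Sum>P\<in>W. of_bool (col P = i) :: real)" for i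
    have "(\<Sum>i<k. z i) = (\<Sum>P\<in>W. \<Sum>i<k. of_bool (col P = i) * 1)"
      unfolding z_def by (subst sum.swap) simp
    then have "(\<Sum>i<k. z i) = N" unfolding one using cW by simp
    moreover have "(\<Sum>i<k. (z i)\<^sup>2) = sam"
    proof -
      have "(\<Sum>i<k. (z i)\<^sup>2) = (\<Sum>i<k. \<Sum>P\<in>W. \<Sum>Q\<in>W. of_bool (col P = i) * of_bool (col Q = i))"
        unfolding z_def power2_eq_square sum_product ..
      also have "\<dots> = (\<Sum>P\<in>W. \<Sum>i<k. \<Sum>Q\<in>W. of_bool (col P = i) * of_bool (col Q = i))" by (rule sum.swap)
      also have "\<dots> = (\<Sum>P\<in>W. \<Sum>Q\<in>W. \<Sum>i<k. of_bool (col P = i) * of_bool (col Q = i))"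
        by (intro sum.cong refl sum.swap)
      also have "\<dots> = sam" unfolding one sam_def by (intro sum.cong refl) (auto simp: of_bool_def)
      finally show ?thesis .
    qed
    ultimately have "N\<^sup>2 \<le> sam * real k"
      using sum_squared_le_sum_of_squares[of z "{..<k}"] by simp
    then show ?thesis using k by (simp add: field_simps)
  qed
  then have dif_le: "dif \<le> N\<^sup>2 - N\<^sup>2 / real k" using total by linarith
  \<comment> \<open>\<open>wrg\<close> counts the adjacent pairs of equal colour and the
    non-adjacent ones of different colours, hence equals \<open>2 * asm + dif - adj\<close>. Since
    \<open>asm \<le> dif - adj \<le> \<Delta>\<close>, it is at most
    \<open>3 * \<Delta>\<close>.\<close>
  have "wrg = (\<Sum>P\<in>W. \<Sum>Q\<in>W. 2 * of_bool (pair_adj E P Q \<and> col P = col Q)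
      + of_bool (col P \<noteq> col Q) - of_bool (pair_adj E P Q))"
    unfolding wrg_def by (intro sum.cong refl) auto
  also have "\<dots> = 2 * asm + dif - adj"
    unfolding asm_def dif_def adj_def by (simp only: sum.distrib sum_subtractf sum_distrib_left)
  finally have "wrg = 2 * asm + dif - adj" .
  moreover have "dif - adj \<le> \<Delta>" unfolding \<Delta> N_def[symmetric] using adjE dif_le by linarith
  ultimately have wrg: "wrg \<le> 3 * \<Delta>" using stab by linarith
  have sam: "sam \<le> N\<^sup>2 / real k + \<Delta>"
    using stab adjE asm0 total unfolding \<Delta> N_def[symmetric] by linarith
  define f where "f a b = col {a, b}" for a b
  have bad: "(\<Sum>a\<in>V. \<Sum>b\<in>V. \<Sum>c\<in>V. \<Sum>d\<in>V. of_bool (\<not> good_quadruple f a b c d)) \<le> 6 * n ^ 3 + 24 * \<Delta>"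
  proof -
    define w where "w P Q = (of_bool (pair_adj E P Q \<longleftrightarrow> col P = col Q) :: real)" for P Q
    \<comment> \<open>For distinct vertices, adjacency in either splitting means
      \<open>{a, b, c, d} \<in> E\<close>. If the colouring is right about both splittings, the
      quadruple is good; so each exception is charged to a repetition or to a wrong
      splitting.\<close>
    have pt: "of_bool (\<not> good_quadruple f a b c d) \<le> of_bool (\<not> distinct [a, b, c, d])
      + of_bool (a \<noteq> b) * (of_bool (c \<noteq> d) * w {a, b} {c, d})
      + of_bool (a \<noteq> c) * (of_bool (b \<noteq> d) * w {a, c} {b, d})" for a b c d
    proof (cases "distinct [a, b, c, d]")
      case True
      have "pair_adj E {a, b} {c, d} \<longleftrightarrow> {a, b, c, d} \<in> E"
        using True unfolding pair_adj_def by (auto simp: insert_commute)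
      moreover have "pair_adj E {a, c} {b, d} \<longleftrightarrow> {a, b, c, d} \<in> E"
        using True unfolding pair_adj_def by (auto simp: insert_commute)
      ultimately show ?thesis using True unfolding w_def good_quadruple_def f_def by auto
    next
      case False
      then show ?thesis unfolding w_def by simp
    qed
    have W1: "(\<Sum>a\<in>V. \<Sum>b\<in>V. \<Sum>c\<in>V. \<Sum>d\<in>V. of_bool (a \<noteq> b) * (of_bool (c \<noteq> d) * w {a, b} {c, d})) = 4 * wrg"
      unfolding sum_ordered_pair_pairs[OF V, of w] unfolding w_def wrg_def W_def ..
    have "(\<Sum>a\<in>V. \<Sum>b\<in>V. \<Sum>c\<in>V. \<Sum>d\<in>V. of_bool (a \<noteq> c) * (of_bool (b \<noteq> d) * w {a, c} {b, d}))
      = (\<Sum>a\<in>V. \<Sum>c\<in>V. \<Sum>b\<in>V. \<Sum>d\<in>V. of_bool (a \<noteq> c) * (of_bool (b \<noteq> d) * w {a, c} {b, d}))"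
      by (intro sum.cong refl sum.swap)
    then have W2: "(\<Sum>a\<in>V. \<Sum>b\<in>V. \<Sum>c\<in>V. \<Sum>d\<in>V. of_bool (a \<noteq> c) * (of_bool (b \<noteq> d) * w {a, c} {b, d})) = 4 * wrg"
      using W1 by simp
    have "(\<Sum>a\<in>V. \<Sum>b\<in>V. \<Sum>c\<in>V. \<Sum>d\<in>V. of_bool (\<not> good_quadruple f a b c d))
      \<le> (\<Sum>a\<in>V. \<Sum>b\<in>V. \<Sum>c\<in>V. \<Sum>d\<in>V. of_bool (\<not> distinct [a, b, c, d])
      + of_bool (a \<noteq> b) * (of_bool (c \<noteq> d) * w {a, b} {c, d})
      + of_bool (a \<noteq> c) * (of_bool (b \<noteq> d) * w {a, c} {b, d}))"
      by (intro sum_mono pt)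
    also have "\<dots> = (\<Sum>a\<in>V. \<Sum>b\<in>V. \<Sum>c\<in>V. \<Sum>d\<in>V. of_bool (\<not> distinct [a, b, c, d])) + 4 * wrg + 4 * wrg"
      unfolding sum.distrib W1 W2 ..
    finally show ?thesis unfolding n using sum_not_distinct4_le[OF V] wrg by linarith
  qed
  have same: "(\<Sum>a\<in>V. \<Sum>b\<in>V. \<Sum>c\<in>V. \<Sum>d\<in>V. of_bool (f a b = f c d)) \<le> 2 * n ^ 3 + 4 * (N\<^sup>2 / real k + \<Delta>)"
  proof -
    have one: "(\<Sum>b\<in>V. of_bool (a = b) :: real) = 1" if "a \<in> V" for a
      using that V by (simp add: of_bool_def)
    have W1: "(\<Sum>a\<in>V. \<Sum>b\<in>V. \<Sum>c\<in>V. \<Sum>d\<in>V. of_bool (a \<noteq> b) * (of_bool (c \<noteq> d) * of_bool (col {a, b} = col {c, d}))) = 4 * sam"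
      unfolding sum_ordered_pair_pairs[OF V, where g = "\<lambda>P Q. of_bool (col P = col Q)"] sam_def W_def ..
    have W2: "(\<Sum>a\<in>V. \<Sum>b\<in>V. \<Sum>c\<in>V. \<Sum>d\<in>V. of_bool (a = b) + of_bool (c = d) :: real) = 2 * n ^ 3"
      unfolding n by (simp add: sum.distrib one eval_nat_numeral cong: sum.cong flip: sum_distrib_left)
    have "(\<Sum>a\<in>V. \<Sum>b\<in>V. \<Sum>c\<in>V. \<Sum>d\<in>V. of_bool (f a b = f c d))
      \<le> (\<Sum>a\<in>V. \<Sum>b\<in>V. \<Sum>c\<in>V. \<Sum>d\<in>V. (of_bool (a = b) + of_bool (c = d))
        + of_bool (a \<noteq> b) * (of_bool (c \<noteq> d) * of_bool (col {a, b} = col {c, d})) :: real)"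
      unfolding f_def by (intro sum_mono) auto
    also have "\<dots> = 2 * n ^ 3 + 4 * sam"
      unfolding W1[symmetric] W2[symmetric] by (simp only: sum.distrib)
    also have "\<dots> \<le> 2 * n ^ 3 + 4 * (N\<^sup>2 / real k + \<Delta>)" using sam by simp
    finally show ?thesis .
  qed
  have "f a b = f b a" "f a b < k" for a b unfolding f_def using colk by (auto simp: insert_commute)
  then show ?thesis using bad same[unfolded N_def] by (intro exI[of _ f] conjI allI)
qed

section \<open>Choice of constants\<close>

theorem theorem2:
  fixes r :: nat
  assumes "r \<ge> 3"
  shows "\<exists>N::nat. \<forall>n\<ge>N. \<forall>(V::'a set) (E::'a set set).
     uniform4_hypergraph V E \<and> card V = n \<and>
     real (card E) \<ge> ((real r - 2) / (real r - 1) - 10 powi (-33) * real r powi (-70)) * real (n choose 4) \<and>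
     \<not> contains_C4 r V E
     \<longrightarrow> (\<exists>p::nat. p \<ge> 1 \<and> r = 2 ^ p + 1)"
proof -
  define c where "c = 10 powi (-33) * real r powi (-70)"
  have c_eq: "c = 1 / (10 ^ 33 * real r ^ 70)"
    unfolding c_def power_int_minus power_int_numeral by (simp only: inverse_mult_distrib divide_inverse mult_1)
  have c0: "c > 0" unfolding c_eq using assms by simp
  define k where "k = r - 1"
  have k: "k > 0" "Suc k = r" "k \<ge> 2" "real k = real r - 1" unfolding k_def using assms by auto
  \<comment> \<open>The almost exact result will be applied with error
    \<open>\<beta> = 7 * c\<close>.\<close>
  have small: "10 ^ 5 * real k ^ 8 * (7 * c) < 1"
  proof -
    have "real k ^ 8 \<le> real r ^ 8" using k by (intro power_mono) auto
    also have "\<dots> \<le> real r ^ 70" using assms by (intro power_increasing) auto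
    finally have "7 * 10 ^ 5 * real k ^ 8 \<le> 7 * 10 ^ 5 * real r ^ 70" by simp
    also have "\<dots> < 10 ^ 33 * real r ^ 70" using assms by (intro mult_strict_right_mono) auto
    finally show ?thesis unfolding c_eq using assms by (simp add: field_simps)
  qed
  \<comment> \<open>The first term gives \<open>30 * x ^ 3 \<le> c * x ^ 4\<close>, so lower order
    terms are absorbed; the summand 4 keeps the factors of \<open>n choose 4\<close>
    positive.\<close>
  define n0 where "n0 = nat \<lceil>30 / c\<rceil> + 4"
  show ?thesis
  proof (rule exI[of _ n0], intro allI impI, elim conjE)
    fix n :: nat and V :: "'a set" and E
    assume n: "n0 \<le> n" and H: "uniform4_hypergraph V E" and card: "card V = n"
      and dens: "real (card E) \<ge> ((real r - 2) / (real r - 1) - 10 powi (-33) * real r powi (-70)) * real (n choose 4)"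
      and free: "\<not> contains_C4 r V E"
    define x where "x = real n"
    have x4: "x \<ge> 4" and "30 / c \<le> x" unfolding x_def using n unfolding n0_def by linarith+
    then have xc: "30 \<le> c * x" using c0 by (simp add: field_simps)
    define M where "M = real (n choose 4)"
    have M: "M = x * (x - 1) * (x - 2) * (x - 3) / 24"
      unfolding M_def x_def by (simp add: binomial_gbinomial gbinomial_prod_rev eval_nat_numeral fact_numeral algebra_simps)
    define N where "N = real (n choose 2)"
    have N: "N = x * (x - 1) / 2"
      unfolding N_def x_def by (simp add: binomial_gbinomial gbinomial_prod_rev eval_nat_numeral fact_numeral algebra_simps)
    define \<Delta> where "\<Delta> = N\<^sup>2 - N\<^sup>2 / real k - 6 * real (card E)"
    have "(real r - 2) / (real r - 1) = 1 - 1 / real k" using k by (simp add: field_simps)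
    then have cE: "real (card E) \<ge> (1 - 1 / real k - c) * M" using dens unfolding c_def M_def by simp
    have "(1 - 1 / real k) * (N\<^sup>2 - 6 * M) + 6 * c * M = N\<^sup>2 - N\<^sup>2 / real k - 6 * ((1 - 1 / real k - c) * M)"
      by (simp add: algebra_simps)
    then have "\<Delta> \<le> (1 - 1 / real k) * (N\<^sup>2 - 6 * M) + 6 * c * M"
      unfolding \<Delta>_def using cE by linarith
    \<comment> \<open>\<open>6 * M\<close> counts the ordered pairs of disjoint vertex pairs, so the
      difference counts the intersecting ones, of order \<open>x ^ 3\<close> only.\<close>
    also have "(1 - 1 / real k) * (N\<^sup>2 - 6 * M) \<le> 1 * (x ^ 3)"
    proof (rule mult_mono)
      have "N\<^sup>2 - 6 * M = x * (x - 1) * (4 * x - 6) / 4"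
        unfolding N M by (simp add: field_simps power2_eq_square)
      moreover have "x ^ 3 - x * (x - 1) * (4 * x - 6) / 4 = x * (10 * x - 6) / 4"
        by (simp add: field_simps eval_nat_numeral)
      moreover have "x * (10 * x - 6) / 4 \<ge> 0" "x * (x - 1) * (4 * x - 6) / 4 \<ge> 0" using x4 by auto
      ultimately show "N\<^sup>2 - 6 * M \<le> x ^ 3" "0 \<le> N\<^sup>2 - 6 * M" by linarith+
    qed (use k in auto)
    also have "6 * c * M \<le> c * x ^ 4 / 4"
    proof -
      have "24 * M = x * (x - 1) * (x - 2) * (x - 3)" unfolding M by simp
      also have "\<dots> \<le> x * x * x * x" using x4 by (intro mult_mono) auto
      also have "\<dots> = x ^ 4" by (simp add: eval_nat_numeral)
      finally have "24 * M \<le> x ^ 4" .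
      then have "c * (24 * M) \<le> c * x ^ 4" using c0 by (intro mult_left_mono) auto
      then show ?thesis by simp
    qed
    finally have D: "\<Delta> \<le> x ^ 3 + c * x ^ 4 / 4" by simp
    have "30 * x ^ 3 \<le> c * x * x ^ 3" using xc x4 by (intro mult_right_mono) auto
    then have x3: "30 * x ^ 3 \<le> c * x ^ 4" by (simp add: eval_nat_numeral mult_ac)
    have x30: "x ^ 3 \<ge> 0" using x4 by simp
    have "N\<^sup>2 \<le> (x * x / 2)\<^sup>2" unfolding N using x4 by (intro power_mono divide_right_mono mult_left_mono) auto
    then have "4 * N\<^sup>2 \<le> x ^ 4" by (simp add: power2_eq_square eval_nat_numeral mult_ac)
    then have N4: "4 * (N\<^sup>2 / real k) \<le> x ^ 4 / real k" using k by (simp add: field_simps)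
    obtain f :: "'a \<Rightarrow> 'a \<Rightarrow> nat" where f: "\<And>a b. f a b = f b a" "\<And>a b. f a b < k"
      and bad: "(\<Sum>a\<in>V. \<Sum>b\<in>V. \<Sum>c\<in>V. \<Sum>d\<in>V. of_bool (\<not> good_quadruple f a b c d)) \<le> 6 * x ^ 3 + 24 * \<Delta>"
      and same: "(\<Sum>a\<in>V. \<Sum>b\<in>V. \<Sum>c\<in>V. \<Sum>d\<in>V. of_bool (f a b = f c d)) \<le> 2 * x ^ 3 + 4 * (N\<^sup>2 / real k + \<Delta>)"
      using exists_almost_quadrangle_colouring[OF H k(1) _ refl refl] free
      unfolding k(2) card x_def[symmetric] N_def[symmetric] \<Delta>_def[symmetric] by blast
    have "\<exists>p. k = 2 ^ p"
    proof (rule almost_quadrangle_colouring_power_of_two[of V x k "7 * c" f])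
      show "finite V" using H unfolding uniform4_hypergraph_def by simp
      show "x = real (card V)" "x > 0" using card x_def x4 by auto
      \<comment> \<open>By \<open>D\<close>, \<open>6 * x ^ 3 + 24 * \<Delta>\<close> is at most
        \<open>30 * x ^ 3 + 6 * c * x ^ 4\<close>, and the cubic term costs one more
        \<open>c * x ^ 4\<close>; hence the factor 7.\<close>
      show "(\<Sum>a\<in>V. \<Sum>b\<in>V. \<Sum>c\<in>V. \<Sum>d\<in>V. of_bool (\<not> good_quadruple f a b c d)) \<le> 7 * c * x ^ 4"
        using bad D x3 by linarith
      note same
      also have "2 * x ^ 3 + 4 * (N\<^sup>2 / real k + \<Delta>) = 4 * (N\<^sup>2 / real k) + (2 * x ^ 3 + 4 * \<Delta>)"
        by (simp add: algebra_simps)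
      also have "\<dots> \<le> x ^ 4 / real k + 7 * (c * x ^ 4)"
        using D x3 x30 by (intro add_mono N4) linarith
      also have "\<dots> = (1 / real k + 7 * c) * x ^ 4" by (simp add: algebra_simps)
      finally show "(\<Sum>a\<in>V. \<Sum>b\<in>V. \<Sum>c\<in>V. \<Sum>d\<in>V. of_bool (f a b = f c d)) \<le> (1 / real k + 7 * c) * x ^ 4" .
    qed (use k f c0 small in auto)
    then obtain p where p: "k = 2 ^ p" by blast
    then have "p \<ge> 1" using k(3) by (cases p) auto
    then show "\<exists>p::nat. p \<ge> 1 \<and> r = 2 ^ p + 1" using p k(2) by auto
  qed
qed

end
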